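(* Let $\beta>0$, $0\le k_0<k_1$ and $\alpha,\varepsilon\in\mathbb{R}$, and set $$\alpha^L_{\beta,\varepsilon}=\frac{-(1+k_0)\big(\beta(\varepsilon-1)+k_0\varepsilon\big)}{k_0+\beta},\qquad \alpha^R_{\beta,\varepsilon}=\frac{-(1+k_1)\big(\beta(\varepsilon-1)+k_1\varepsilon\big)}{k_1+\beta}.$$ Suppose that $\alpha(1-\beta)\neq 0$, $\alpha<\alpha^L_{\beta,\varepsilon}$ and $\alpha>\alpha^R_{\beta,\varepsilon}$. Consider the piecewise smooth Welander system $$\dot T=1-T-k(\rho)T,\qquad \dot S=\beta(1-S)-k(\rho)S,\qquad \rho=-\alpha T+S,$$ with $k(\rho)=k_1$ if $\rho>\varepsilon$ and $k(\rho)=k_0$ if $\rho\le\varepsilon$. Then: (i) if $\varepsilon\ge 0$, the system does not have crossing periodic orbits; (ii) if $\varepsilon<0$, the system has a unique crossing periodic orbit, and it is stable.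
   Context: The system is a planar piecewise linear (Filippov) system with discontinuity line $\Sigma=\{(T,S)\in\mathbb{R}^2: f(T,S)=0\}$, $f(T,S)=S-\alpha T-\varepsilon$. Let $Z^{+}$ (resp. $Z^{-}$) be the linear vector field on $\mathbb{R}^2$ obtained by setting $k=k_1$ (resp. $k=k_0$); the system is governed by $Z^+$ on $\{f>0\}$ and by $Z^-$ on $\{f<0\}$. For $p\in\Sigma$ write $Z^{\pm}f(p)=\langle\nabla f(p),Z^{\pm}(p)\rangle$. A point $p\in\Sigma$ is a crossing point if $Z^+f(p)\cdot Z^-f(p)>0$; the solution through a crossing point is obtained by concatenating the solution arcs of $Z^+$ and $Z^-$. A crossing periodic orbit is a closed orbit, made of arcs of trajectories of $Z^+$ in $\{f>0\}$ and of $Z^-$ in $\{f<0\}$, which meets $\Sigma$ in a nonempty finite set of points, all of which are crossing points. It is called stable if the orbits of the system starting sufficiently near it converge to it in forward time. *)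

theory Defs
  imports "HOL-Analysis.Analysis"
begin

text \<open>Points of the plane are pairs \<open>(T, S)\<close>.\<close>

definition mixing :: "real \<Rightarrow> real \<Rightarrow> real \<Rightarrow> real \<Rightarrow> real" where
  "mixing k0 k1 \<epsilon> \<rho> = (if \<rho> > \<epsilon> then k1 else k0)"

definition linear_field :: "real \<Rightarrow> real \<Rightarrow> real \<times> real \<Rightarrow> real \<times> real" where
  "linear_field \<beta> k = (\<lambda>(T, S). (1 - T - k * T, \<beta> * (1 - S) - k * S))"

text \<open>\<open>Z\<^sup>+\<close> is \<open>linear_field \<beta> k1\<close> and \<open>Z\<^sup>-\<close> is \<open>linear_field \<beta> k0\<close>.\<close>

definition welander_field ::
    "real \<Rightarrow> real \<Rightarrow> real \<Rightarrow> real \<Rightarrow> real \<Rightarrow> real \<times> real \<Rightarrow> real \<times> real" where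
  "welander_field \<alpha> \<beta> k0 k1 \<epsilon> =
     (\<lambda>(T, S). linear_field \<beta> (mixing k0 k1 \<epsilon> (- \<alpha> * T + S)) (T, S))"

definition switch_fun :: "real \<Rightarrow> real \<Rightarrow> real \<times> real \<Rightarrow> real" where
  "switch_fun \<alpha> \<epsilon> = (\<lambda>(T, S). S - \<alpha> * T - \<epsilon>)"

definition switch_line :: "real \<Rightarrow> real \<Rightarrow> (real \<times> real) set" where
  "switch_line \<alpha> \<epsilon> = {p. switch_fun \<alpha> \<epsilon> p = 0}"

text \<open>The gradient of \<open>switch_fun \<alpha> \<epsilon>\<close> is the constant vector \<open>(- \<alpha>, 1)\<close>.\<close>

definition switch_deriv ::
    "real \<Rightarrow> (real \<times> real \<Rightarrow> real \<times> real) \<Rightarrow> real \<times> real \<Rightarrow> real" where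
  "switch_deriv \<alpha> Z p = (- \<alpha>, 1) \<bullet> Z p"

definition crossing_point ::
    "real \<Rightarrow> real \<Rightarrow> real \<Rightarrow> real \<Rightarrow> real \<Rightarrow> real \<times> real \<Rightarrow> bool" where
  "crossing_point \<alpha> \<beta> k0 k1 \<epsilon> p \<longleftrightarrow>
     p \<in> switch_line \<alpha> \<epsilon> \<and>
     switch_deriv \<alpha> (linear_field \<beta> k1) p * switch_deriv \<alpha> (linear_field \<beta> k0) p > 0"

text \<open>
  A continuous concatenation, on the time interval \<open>I\<close>, of solution arcs of \<open>Z\<^sup>+\<close> in \<open>{f > 0}\<close>
  and of \<open>Z\<^sup>-\<close> in \<open>{f < 0}\<close>, glued at crossing points. No derivative is prescribed at the gluing
  times; the finiteness condition on these times excludes curves that rest on, or move along, the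
  switching line. Since the curve is continuous and \<open>Z\<^sup>\<plusminus>\<close> are continuous, at a gluing
  time the one-sided derivatives are the values of \<open>Z\<^sup>\<plusminus>\<close> for the adjacent arcs.
\<close>

definition crossing_solution ::
    "real \<Rightarrow> real \<Rightarrow> real \<Rightarrow> real \<Rightarrow> real \<Rightarrow> real set \<Rightarrow> (real \<Rightarrow> real \<times> real) \<Rightarrow> bool" where
  "crossing_solution \<alpha> \<beta> k0 k1 \<epsilon> I x \<longleftrightarrow>
     continuous_on I x \<and>
     (\<forall>t\<in>I. x t \<notin> switch_line \<alpha> \<epsilon> \<longrightarrow>
        (x has_vector_derivative welander_field \<alpha> \<beta> k0 k1 \<epsilon> (x t)) (at t within I)) \<and>
     (\<forall>t\<in>I. x t \<in> switch_line \<alpha> \<epsilon> \<longrightarrow> crossing_point \<alpha> \<beta> k0 k1 \<epsilon> (x t)) \<and>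
     (\<forall>a b. finite {t \<in> I \<inter> {a..b}. x t \<in> switch_line \<alpha> \<epsilon>})"

definition crossing_periodic_orbit ::
    "real \<Rightarrow> real \<Rightarrow> real \<Rightarrow> real \<Rightarrow> real \<Rightarrow> (real \<times> real) set \<Rightarrow> bool" where
  "crossing_periodic_orbit \<alpha> \<beta> k0 k1 \<epsilon> \<Gamma> \<longleftrightarrow>
     (\<exists>x P. P > 0 \<and> (\<forall>t. x (t + P) = x t) \<and>
        crossing_solution \<alpha> \<beta> k0 k1 \<epsilon> UNIV x \<and> \<Gamma> = range x) \<and>
     \<Gamma> \<inter> switch_line \<alpha> \<epsilon> \<noteq> {} \<and> finite (\<Gamma> \<inter> switch_line \<alpha> \<epsilon>)"

text \<open>
  The existence clause makes the convergence clause non-vacuous: every point near \<open>\<Gamma>\<close> has an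
  orbit defined for all forward time.
\<close>

definition stable_orbit ::
    "real \<Rightarrow> real \<Rightarrow> real \<Rightarrow> real \<Rightarrow> real \<Rightarrow> (real \<times> real) set \<Rightarrow> bool" where
  "stable_orbit \<alpha> \<beta> k0 k1 \<epsilon> \<Gamma> \<longleftrightarrow>
     (\<exists>\<delta>>0. \<forall>p. infdist p \<Gamma> < \<delta> \<longrightarrow>
        (\<exists>x. crossing_solution \<alpha> \<beta> k0 k1 \<epsilon> {0..} x \<and> x 0 = p) \<and>
        (\<forall>x. crossing_solution \<alpha> \<beta> k0 k1 \<epsilon> {0..} x \<and> x 0 = p \<longrightarrow>
           ((\<lambda>t. infdist (x t) \<Gamma>) \<longlongrightarrow> 0) at_top))"

definition alpha_L :: "real \<Rightarrow> real \<Rightarrow> real \<Rightarrow> real" where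
  "alpha_L \<beta> \<epsilon> k0 = - (1 + k0) * (\<beta> * (\<epsilon> - 1) + k0 * \<epsilon>) / (k0 + \<beta>)"

definition alpha_R :: "real \<Rightarrow> real \<Rightarrow> real \<Rightarrow> real" where
  "alpha_R \<beta> \<epsilon> k1 = - (1 + k1) * (\<beta> * (\<epsilon> - 1) + k1 * \<epsilon>) / (k1 + \<beta>)"

end

theory Submission
  imports Defs
begin

text \<open>
  On the switching line $f=0$ the quantity $Z^+f - Z^-f$ is the constant $(k_0-k_1)\varepsilon$,
  called the gain below, and the two bounds on $\alpha$ place the node of each linear field on
  the far side of the line. A trajectory that enters a side must therefore come back to the
  line, and one turn of a trajectory consists of two such flights.

  Along either field, $f$ is a damped linear motion about an equilibrium beyond the line. For
  such a motion (\<open>launch\<close>, \<open>landing\<close>) the landing speed is smaller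
  than the launch speed, and, since the loss of speed increases with the launch speed, the
  landing speed is a strictly contracting function of it (\<open>landing_contracts\<close>). At
  the line the trajectory changes to the other field, which adds the gain to its speed. In terms
  of crossing speeds a half turn is thus a strict contraction followed by a translation
  (\<open>half_turn\<close>).

  If $\varepsilon\ge 0$, the translation does not raise the speed. Crossing speeds then decrease
  strictly along every orbit, and none of them closes up
  (\<open>no_crossing_periodic_orbit\<close>).

  If $\varepsilon<0$, the gain is positive. Then no trajectory gets stuck at the line after a
  flight, and the return map is a strict contraction with bounded values. Its fixed point exists
  (\<open>return_fixed_point\<close>), is unique and attracts all crossing speeds. It yields the
  periodic orbit (\<open>periodic_orbit_exists\<close>) and its uniqueness
  (\<open>periodic_orbit_eq_cycle\<close>). Since flights depend continuously on their initial
  speed, convergence of the speeds gives convergence of the trajectories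
  (\<open>sol_tends_to_cycle\<close>).

  The definition of a solution does not prescribe derivatives on the line and does not come with
  existence or uniqueness. The link with the half turns is \<open>sol_after_exit\<close>, by
  which a crossing solution has to follow the linear flow for a whole flight. In the other
  direction, \<open>crossing_solution_concatenate\<close> chains flights into solutions.
\<close>

section \<open>A damped scalar return problem\<close>

text \<open>
  The chord slope $(e^{ct}-1)/c$ of the convex function $c \mapsto e^{ct}$ increases with $c$,
  for either sign of $t$. Nearly all signs below that involve two decay rates come from this
  fact or from its odd part in $t$.
\<close>

lemma exp_chord_less:
  fixes a b t :: real
  assumes "0 < a" "a < b" "t \<noteq> 0"
  shows "b * (exp (a * t) - 1) < a * (exp (b * t) - 1)"
proof -
  define r where "r = (\<lambda>t. a * (exp (b * t) - 1) - b * (exp (a * t) - 1))"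
  have d: "(r has_real_derivative a * b * (exp (b * t) - exp (a * t))) (at t)" for t
    unfolding r_def by (auto intro!: derivative_eq_intros simp: algebra_simps)
  have "r 0 < r t"
  proof (cases "t > 0")
    case True
    show ?thesis
    proof (rule DERIV_pos_imp_increasing_open[OF True])
      fix x assume "0 < x" "x < t"
      then show "\<exists>y. (r has_real_derivative y) (at x) \<and> y > 0"
        using assms by (intro exI[of _ "a * b * (exp (b * x) - exp (a * x))"]) (auto simp: d)
    next
      show "continuous_on {0..t} r" unfolding r_def by (intro continuous_intros)
    qed
  next
    case False
    then have t: "t < 0" using assms by simp
    show ?thesis
    proof (rule DERIV_neg_imp_decreasing_open[OF t])
      fix x assume "t < x" "x < 0"
      then show "\<exists>y. (r has_real_derivative y) (at x) \<and> y < 0"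
        using assms by (intro exI[of _ "a * b * (exp (b * x) - exp (a * x))"])
          (auto simp: d mult_less_0_iff intro!: mult_pos_neg)
    next
      show "continuous_on {t..0} r" unfolding r_def by (intro continuous_intros)
    qed
  qed
  then show ?thesis by (simp add: r_def)
qed

lemma sinh_chord_less:
  fixes a b t :: real
  assumes "0 < a" "a < b" "t > 0"
  shows "b * (exp (a * t) - exp (- a * t)) < a * (exp (b * t) - exp (- b * t))"
proof -
  define r where "r = (\<lambda>t. a * (exp (b * t) - exp (- b * t)) - b * (exp (a * t) - exp (- a * t)))"
  have d: "(r has_real_derivative a * b * (exp (b * t) + exp (- b * t) - exp (a * t) - exp (- a * t))) (at t)" for t
    unfolding r_def by (auto intro!: derivative_eq_intros simp: algebra_simps)
  have "r 0 < r t"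
  proof (rule DERIV_pos_imp_increasing_open[OF assms(3)])
    fix x assume x: "0 < x" "x < t"
    have "cosh (a * x) < cosh (b * x)"
      using assms x by (subst cosh_real_strict_mono) auto
    then have "exp (b * x) + exp (- b * x) - exp (a * x) - exp (- a * x) > 0"
      by (simp add: cosh_def)
    then show "\<exists>y. (r has_real_derivative y) (at x) \<and> y > 0"
      using assms d[of x] by (intro exI[of _ "a * b * (exp (b * x) + exp (- b * x) - exp (a * x) - exp (- a * x))"]) auto
  next
    show "continuous_on {0..t} r" unfolding r_def by (intro continuous_intros)
  qed
  then show ?thesis by (simp add: r_def)
qed

lemma exp_decay_tendsto:
  fixes c :: real
  assumes "c > 0"
  shows "((\<lambda>t. exp (- c * t)) \<longlongrightarrow> 0) at_top"
  by (rule filterlim_compose[OF exp_at_bot])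
    (use assms in \<open>intro filterlim_tendsto_neg_mult_at_bot[OF tendsto_const _ filterlim_ident], auto\<close>)

text \<open>
  Consider $x'' + (a+b)x' + ab(x+1) = 0$ with $x(0)=0$, a damped motion above an equilibrium at
  depth $1$. Its solution is $x(t) = \frac{e^{-at}-e^{-bt}}{b-a}(x'(0) - w(t))$, where $w$ is
  the function \<open>launch a b\<close>: a motion launched upwards with speed $w(t)$ is back at
  height $0$ at time $t$. The formula holds for $t<0$ as well, so reversing time shows that this
  motion comes down with speed $-w(-t)$. At $t=0$ the quotient is $0/0$, and the statements
  below avoid that point.
\<close>

definition launch :: "real \<Rightarrow> real \<Rightarrow> real \<Rightarrow> real" where
  "launch a b t = (b * (1 - exp (- a * t)) - a * (1 - exp (- b * t))) / (exp (- a * t) - exp (- b * t))"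

text \<open>
  Either of the two rates may be the larger one, since $\beta - 1$ may have either sign. Thanks
  to this symmetry it suffices to compute with $a<b$.
\<close>

lemma launch_commute: "launch a b t = launch b a t"
proof -
  have "launch a b t = (- (b * (1 - exp (- a * t)) - a * (1 - exp (- b * t)))) / (- (exp (- a * t) - exp (- b * t)))"
    unfolding launch_def by (rule minus_divide_divide[symmetric])
  also have "\<dots> = launch b a t" unfolding launch_def by simp
  finally show ?thesis .
qed

text \<open>
  The derivative is factored so that its last factor is the difference in
  \<open>exp_chord_less\<close>.
\<close>

lemma launch_deriv:
  assumes "a \<noteq> b" "t \<noteq> 0"
  shows "(launch a b has_real_derivative
     (b - a) * exp (- a * t) * exp (- b * t) * (a * (exp (b * t) - 1) - b * (exp (a * t) - 1))
       / (exp (- a * t) - exp (- b * t))\<^sup>2) (at t)"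
proof -
  have nz: "exp (- a * t) - exp (- b * t) \<noteq> 0" using assms by simp
  have e: "exp (a * t) = 1 / exp (- a * t)" "exp (b * t) = 1 / exp (- b * t)"
    by (simp_all add: exp_minus inverse_eq_divide)
  define A B where "A = exp (- a * t)" and "B = exp (- b * t)"
  have AB: "A > 0" "B > 0" "A - B \<noteq> 0" using nz by (auto simp: A_def B_def)
  have "(launch a b has_real_derivative
     ((b * (a * A) - a * (b * B)) * (A - B) - (b * (1 - A) - a * (1 - B)) * (- a * A + b * B)) / ((A - B) * (A - B))) (at t)"
    unfolding launch_def[abs_def] A_def B_def
    by (rule derivative_eq_intros refl nz | simp)+ (simp add: algebra_simps)
  moreover have "((b * (a * A) - a * (b * B)) * (A - B) - (b * (1 - A) - a * (1 - B)) * (- a * A + b * B))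
      = (b - a) * A * B * (a * (1 / B - 1) - b * (1 / A - 1))"
    using AB by (simp add: field_simps)
  ultimately show ?thesis
    unfolding e A_def[symmetric] B_def[symmetric] power2_eq_square by simp
qed

lemma launch_deriv_pos:
  assumes "0 < a" "a < b" "t \<noteq> 0"
  obtains D where "(launch a b has_real_derivative D) (at t)" "D > 0"
proof
  show "(b - a) * exp (- a * t) * exp (- b * t) * (a * (exp (b * t) - 1) - b * (exp (a * t) - 1))
       / (exp (- a * t) - exp (- b * t))\<^sup>2 > 0"
    using exp_chord_less[OF assms] assms by (intro divide_pos_pos mult_pos_pos) auto
qed (rule launch_deriv, use assms in auto)

lemma launch_continuous_on:
  assumes "a \<noteq> b" "0 \<notin> A"
  shows "continuous_on A (launch a b)"
  using launch_deriv[OF assms(1)] assms(2) by (metis DERIV_isCont continuous_at_imp_continuous_on)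

text \<open>
  On the positive half-line this says that faster launches last longer. On the negative
  half-line it says that longer flights come down faster.
\<close>

lemma launch_strict_mono:
  assumes "0 < a" "0 < b" "a \<noteq> b" "s < t" "0 < s \<or> t < 0"
  shows "launch a b s < launch a b t"
proof -
  have *: "launch a b s < launch a b t" if "0 < a" "a < b" for a b
  proof (rule DERIV_pos_imp_increasing_open[OF \<open>s < t\<close>])
    fix x assume "s < x" "x < t"
    then show "\<exists>y. (launch a b has_real_derivative y) (at x) \<and> y > 0"
      using launch_deriv_pos[OF that, of x] assms(5) by force
  next
    show "continuous_on {s..t} (launch a b)" using that assms(5) by (intro launch_continuous_on) auto
  qed
  show ?thesis using *[of a b] *[of b a] assms launch_commute[of a b] by (cases "a < b") auto
qed

lemma launch_pos:
  assumes "0 < a" "0 < b" "a \<noteq> b" "t > 0"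
  shows "launch a b t > 0"
proof -
  have *: "launch a b t > 0" if "0 < a" "a < b" for a b
    using exp_chord_less[OF that, of "- t"] assms that
    unfolding launch_def by (intro divide_pos_pos) (auto simp: algebra_simps)
  show ?thesis using *[of a b] *[of b a] assms launch_commute[of a b] by (cases "a < b") auto
qed

lemma launch_neg:
  assumes "0 < a" "0 < b" "a \<noteq> b" "t > 0"
  shows "launch a b (- t) < 0"
proof -
  have *: "launch a b (- t) < 0" if "0 < a" "a < b" for a b
    using exp_chord_less[OF that, of "t"] assms that
    unfolding launch_def by (intro divide_pos_neg) (auto simp: algebra_simps)
  show ?thesis using *[of a b] *[of b a] assms launch_commute[of a b] by (cases "a < b") auto
qed

text \<open>
  The sum is launch speed minus landing speed, so this is the loss of speed caused by the
  damping. After clearing the denominator, its derivative is again controlled by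
  \<open>exp_chord_less\<close>.
\<close>

lemma launch_loss:
  assumes "0 < a" "0 < b" "a \<noteq> b" "t > 0"
  shows "launch a b t + launch a b (- t) > 0"
proof -
  have *: "launch a b t + launch a b (- t) > 0" if ab: "0 < a" "a < b" for a b
  proof -
    define n where "n = (\<lambda>t. (b - a) * (1 - exp (- (a + b) * t)) - (a + b) * (exp (- a * t) - exp (- b * t)))"
    have "n 0 < n t"
    proof (rule DERIV_pos_imp_increasing_open[OF assms(4)])
      fix x assume x: "0 < x" "x < t"
      have "(n has_real_derivative (a + b) * ((b - a) * exp (- (a + b) * x) + a * exp (- a * x) - b * exp (- b * x))) (at x)"
        unfolding n_def by (auto intro!: derivative_eq_intros simp: algebra_simps)
      moreover have "exp (- a * x) * exp (- b * x) * (a * (exp (b * x) - 1) - b * (exp (a * x) - 1))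
        = (b - a) * exp (- (a + b) * x) + a * exp (- a * x) - b * exp (- b * x)"
        by (simp add: algebra_simps flip: exp_add)
      moreover have "exp (- a * x) * exp (- b * x) * (a * (exp (b * x) - 1) - b * (exp (a * x) - 1)) > 0"
        using exp_chord_less[OF ab, of x] x by (intro mult_pos_pos) auto
      ultimately show "\<exists>y. (n has_real_derivative y) (at x) \<and> y > 0"
        using ab by (metis add_pos_pos less_trans mult_pos_pos)
    next
      show "continuous_on {0..t} n" unfolding n_def by (intro continuous_intros)
    qed
    then have n: "n t > 0" by (simp add: n_def)
    define A B where "A = exp (- a * t)" and "B = exp (- b * t)"
    have AB: "A > 0" "B > 0" "B < A" using ab assms by (auto simp: A_def B_def)
    have e: "exp (a * t) = 1 / A" "exp (b * t) = 1 / B" "exp (- (a + b) * t) = A * B"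
      by (simp_all add: A_def B_def exp_minus inverse_eq_divide flip: exp_add) (simp add: left_diff_distrib exp_minus exp_add exp_diff inverse_eq_divide)
    have "launch a b t + launch a b (- t) = (b * (1 - A) - a * (1 - B)) / (A - B) + (b * (1 - 1 / A) - a * (1 - 1 / B)) / (1 / A - 1 / B)"
      unfolding launch_def by (simp add: e) (simp add: A_def B_def)
    also have "\<dots> = n t / (A - B)"
      unfolding n_def e A_def[symmetric] B_def[symmetric] using AB
      by (simp add: divide_simps) (simp add: algebra_simps)
    finally show ?thesis using n AB by simp
  qed
  show ?thesis using *[of a b] *[of b a] assms launch_commute[of a b] by (cases "a < b") auto
qed

text \<open>
  This is the inequality behind uniqueness and stability: the loss of speed grows with the
  flight time, hence with the launch speed, so that the landing speed depends on the launch
  speed with slope less than one. The derivative of the loss is a positive multiple of the odd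
  part in $t$ of the difference in \<open>exp_chord_less\<close>, whence
  \<open>sinh_chord_less\<close>.
\<close>

lemma launch_loss_strict_mono:
  assumes "0 < a" "0 < b" "a \<noteq> b" "0 < s" "s < t"
  shows "launch a b s + launch a b (- s) < launch a b t + launch a b (- t)"
proof -
  have *: "launch a b s + launch a b (- s) < launch a b t + launch a b (- t)" if ab: "0 < a" "a < b" for a b
  proof (rule DERIV_pos_imp_increasing_open[OF \<open>s < t\<close>, of "\<lambda>t. launch a b t + launch a b (- t)"])
    fix x assume x: "s < x" "x < t"
    then have x0: "x > 0" using assms by simp
    define D where "D = (\<lambda>t. (b - a) * exp (- a * t) * exp (- b * t) * (a * (exp (b * t) - 1) - b * (exp (a * t) - 1))
       / (exp (- a * t) - exp (- b * t))\<^sup>2)"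
    have "((\<lambda>t. launch a b t + launch a b (- t)) has_real_derivative D x - D (- x)) (at x)"
    proof -
      have 1: "(launch a b has_real_derivative D x) (at x)"
        unfolding D_def using launch_deriv[of a b x] ab x0 by simp
      have 2: "(launch a b has_real_derivative D (- x)) (at (- x))"
        unfolding D_def using launch_deriv[of a b "- x"] ab x0 by simp
      have "((\<lambda>t. launch a b (- t)) has_real_derivative D (- x) * (- 1)) (at x)"
        by (rule DERIV_chain2[where f = "launch a b" and g = uminus, OF 2]) (auto intro!: derivative_eq_intros)
      from DERIV_add[OF 1 this] show ?thesis by simp
    qed
    moreover have "D x - D (- x) > 0"
    proof -
      define A B where "A = exp (- a * x)" and "B = exp (- b * x)"
      have AB: "A > 0" "B > 0" "B < A" using ab x0 by (auto simp: A_def B_def)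
      have e: "exp (a * x) = 1 / A" "exp (b * x) = 1 / B"
        by (simp_all add: A_def B_def exp_minus inverse_eq_divide)
      have "D (- x) = (b - a) * (1 / A) * (1 / B) * (a * (B - 1) - b * (A - 1)) / (1 / A - 1 / B)\<^sup>2"
        unfolding D_def A_def B_def by (simp add: exp_minus inverse_eq_divide)
      also have "1 / A - 1 / B = - (A - B) / (A * B)"
        using AB by (simp add: field_simps)
      also have "(b - a) * (1 / A) * (1 / B) * (a * (B - 1) - b * (A - 1)) / (- (A - B) / (A * B))\<^sup>2
         = (b - a) * (A * B) * (a * (B - 1) - b * (A - 1)) / (A - B)\<^sup>2"
        using AB by (simp add: power_divide divide_simps power2_eq_square) (simp add: algebra_simps)
      finally have m: "D (- x) = \<dots>" .
      have "D x = (b - a) * A * B * (a * (1 / B - 1) - b * (1 / A - 1)) / (A - B)\<^sup>2"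
        by (simp add: D_def e) (simp add: A_def B_def)
      with m have "D x - D (- x) = (b - a) * A * B * (a * (1 / B - 1) - b * (1 / A - 1)) / (A - B)\<^sup>2
         - (b - a) * (A * B) * (a * (B - 1) - b * (A - 1)) / (A - B)\<^sup>2"
        by simp
      also have "\<dots> = (b - a) * A * B * (a * (1 / B - B) - b * (1 / A - A)) / (A - B)\<^sup>2"
        by (simp add: algebra_simps flip: diff_divide_distrib)
      also have "\<dots> > 0"
        using sinh_chord_less[OF ab x0, unfolded e] AB ab
        by (intro divide_pos_pos mult_pos_pos) (auto simp: A_def B_def)
      finally show ?thesis .
    qed
    ultimately show "\<exists>y. ((\<lambda>t. launch a b t + launch a b (- t)) has_real_derivative y) (at x) \<and> y > 0"
      by blast
  next
    have "continuous_on {s..t} (\<lambda>t. launch a b (- t))"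
      by (rule continuous_on_compose2[OF launch_continuous_on[of a b "{..<0}"]])
        (use ab assms in \<open>auto intro!: continuous_intros\<close>)
    then show "continuous_on {s..t} (\<lambda>t. launch a b t + launch a b (- t))"
      using ab assms by (intro continuous_on_add launch_continuous_on) auto
  qed
  show ?thesis using *[of a b] *[of b a] assms launch_commute[of a b] by (cases "a < b") auto
qed

text \<open>
  However fast the launch, the motion stays on one side of the invariant line $x' = -a(x+1)$ of
  the phase plane and therefore comes down with speed less than $a$. This bound provides the a
  priori estimate for the fixed point of the return map.
\<close>

lemma launch_minus_bound:
  assumes "0 < a" "0 < b" "a \<noteq> b" "t > 0"
  shows "- launch a b (- t) < a"
proof -
  define A B where "A = exp (- a * t)" and "B = exp (- b * t)"
  have AB: "A > 0" "B > 0" "A - B \<noteq> 0" "A < 1" "b > a \<longleftrightarrow> A > B" using assms by (auto simp: A_def B_def)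
  have e: "exp (a * t) = 1 / A" "exp (b * t) = 1 / B" 
      by (simp_all add: A_def B_def exp_minus inverse_eq_divide)
  have "a + launch a b (- t) = a + (b * (1 - 1 / A) - a * (1 - 1 / B)) / (1 / A - 1 / B)"
      unfolding launch_def by (simp add: e)
  also have "\<dots> = B * (1 - A) * ((b - a) / (A - B))"
    using AB by (simp add: divide_simps) (simp add: algebra_simps)
  also have "\<dots> > 0"
    using AB assms(3) by (cases "a < b") (auto intro!: mult_pos_pos divide_pos_pos divide_neg_neg mult_pos_neg)
  finally show ?thesis by simp
qed

lemma launch_onto:
  assumes "0 < a" "0 < b" "a \<noteq> b" "u > 0"
  obtains t where "t > 0" "launch a b t = u"
proof -
  have *: "\<exists>t>0. launch a b t = u" if ab: "0 < a" "a < b" for a b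
  proof -
    \<comment> \<open>The equation $w(t)=u$ without its denominator, which would be singular at $0$.\<close>
    define F where "F = (\<lambda>t. u * (exp (- a * t) - exp (- b * t)) - (b * (1 - exp (- a * t)) - a * (1 - exp (- b * t))))"
    \<comment> \<open>$F$ starts at $0$ with positive slope and is eventually negative.\<close>
    have "(F has_real_derivative u * (b - a)) (at 0)"
      unfolding F_def by (auto intro!: derivative_eq_intros simp: algebra_simps)
    from DERIV_pos_inc_right[OF this] obtain e where e: "e > 0" "\<And>h. h > 0 \<Longrightarrow> h < e \<Longrightarrow> F 0 < F (0 + h)"
      using ab assms by auto
    have p: "F (e / 2) > 0" using e(2)[of "e / 2"] e(1) by (simp add: F_def)
    have "(F \<longlongrightarrow> u * (0 - 0) - (b * (1 - 0) - a * (1 - 0))) at_top"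
      unfolding F_def by (intro tendsto_intros exp_decay_tendsto) (use ab in auto)
    then have "eventually (\<lambda>t. F t < 0) at_top" 
      by (rule order_tendstoD) (use ab in auto)
    then have "eventually (\<lambda>t. F t < 0 \<and> t > e / 2) at_top"
      by (intro eventually_conj eventually_gt_at_top)
    then obtain t where t: "F t < 0" "t > e / 2"
      using eventually_happens'[OF trivial_limit_at_top_linorder] by blast
    obtain r where r: "e / 2 \<le> r" "r \<le> t" "F r = 0"
      using IVT2'[of F t 0 "e / 2"] p t by (force simp: F_def intro!: continuous_intros)
    then have "r > 0" using e by simp
    moreover then have "exp (- a * r) - exp (- b * r) > 0" using ab by simp
    ultimately show ?thesis using r(3) by (intro exI[of _ r]) (auto simp: F_def launch_def field_simps)
  qed
  show ?thesis using *[of a b] *[of b a] assms launch_commute[of a b] that by (cases "a < b") auto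
qed

definition flight_time :: "real \<Rightarrow> real \<Rightarrow> real \<Rightarrow> real" where
  "flight_time a b u = (THE t. t > 0 \<and> launch a b t = u)"

definition landing :: "real \<Rightarrow> real \<Rightarrow> real \<Rightarrow> real" where
  "landing a b u = - launch a b (- flight_time a b u)"

context
  fixes a b :: real
  assumes ab: "0 < a" "0 < b" "a \<noteq> b"
begin

lemma flight_time_launch:
  assumes "t > 0"
  shows "flight_time a b (launch a b t) = t"
  unfolding flight_time_def
  by (rule the_equality) (use assms in auto, metis ab launch_strict_mono less_irrefl linorder_neqE)

lemma flight_time:
  assumes "u > 0"
  shows "flight_time a b u > 0" "launch a b (flight_time a b u) = u"
  using launch_onto[OF ab assms] flight_time_launch by metis+

lemma launch_less_iff:
  assumes "t > 0" "u > 0"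
  shows "launch a b t < u \<longleftrightarrow> t < flight_time a b u"
  using launch_strict_mono[OF ab] flight_time[OF assms(2)] assms(1)
  by (metis less_asym' linorder_less_linear)

lemma flight_time_strict_mono:
  assumes "0 < u" "u < v"
  shows "flight_time a b u < flight_time a b v"
  using launch_less_iff[of "flight_time a b u" v] flight_time[of u] assms by simp

lemma flight_time_isCont:
  assumes "u > 0"
  shows "isCont (flight_time a b) u"
proof -
  define t where "t = flight_time a b u"
  have t: "t > 0" "launch a b t = u" using flight_time[OF assms] by (auto simp: t_def)
  have "isCont (flight_time a b) (launch a b t)"
  proof (rule isCont_inverse_function[where f = "launch a b" and d = "t / 2"])
    fix z assume "\<bar>z - t\<bar> \<le> t / 2"
    then have z: "z > 0" using t(1) by linarith
    then show "flight_time a b (launch a b z) = z" using flight_time_launch by blast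
    show "isCont (launch a b) z" using launch_deriv[of a b z] ab z DERIV_isCont by blast
  qed (use t in auto)
  then show ?thesis by (simp add: t)
qed

lemma landing_pos: "u > 0 \<Longrightarrow> landing a b u > 0"
  using launch_neg[OF ab] flight_time by (simp add: landing_def)

lemma landing_less: "u > 0 \<Longrightarrow> landing a b u < u"
  using launch_loss[OF ab, of "flight_time a b u"] flight_time[of u] by (simp add: landing_def)

lemma landing_less_rate: "u > 0 \<Longrightarrow> landing a b u < a"
  using launch_minus_bound[OF ab, of "flight_time a b u"] flight_time[of u] by (simp add: landing_def)

text \<open>
  The landing speed and the lost speed both increase with the launch speed, and they add up to
  it.
\<close>

lemma landing_contracts:
  assumes "0 < u" "0 < v" "u \<noteq> v"
  shows "\<bar>landing a b u - landing a b v\<bar> < \<bar>u - v\<bar>"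
proof -
  have *: "landing a b u < landing a b v \<and> landing a b v - landing a b u < v - u" if "0 < u" "u < v" for u v
  proof -
    have t: "0 < flight_time a b u" "flight_time a b u < flight_time a b v"
      using flight_time flight_time_strict_mono that by auto
    show ?thesis
      using launch_strict_mono[OF ab, of "- flight_time a b v" "- flight_time a b u"]
        launch_loss_strict_mono[OF ab t] t flight_time[of u] flight_time[of v] that
      by (auto simp: landing_def)
  qed
  show ?thesis using *[of u v] *[of v u] assms by (cases "u < v") auto
qed

end


section \<open>The linear flows and the switching line\<close>

text \<open>
  The two linear fields are treated together. A side \<open>s\<close> of the switching line is
  $1$ for $\{f>0\}$ and $-1$ for $\{f<0\}$, and \<open>mix s\<close> is the value of $k$ that
  governs it. The function $s f$ is then positive on side \<open>s\<close>, and along the field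
  of that side it solves the scalar problem above, with rates \<open>lam s\<close> and
  \<open>mu s\<close> for $T$ and $S$ and with an equilibrium at depth \<open>depth s\<close>
  instead of $1$.
\<close>

locale welander =
  fixes \<alpha> \<beta> k0 k1 \<epsilon> :: real
  assumes beta_pos: "\<beta> > 0" and k0_nonneg: "0 \<le> k0" and k0_less_k1: "k0 < k1"
    and nondegenerate: "\<alpha> * (1 - \<beta>) \<noteq> 0"
    and alpha_less: "\<alpha> < alpha_L \<beta> \<epsilon> k0" and alpha_greater: "\<alpha> > alpha_R \<beta> \<epsilon> k1"
begin

abbreviation f where "f \<equiv> switch_fun \<alpha> \<epsilon>"

definition mix :: "real \<Rightarrow> real" where "mix s = (if s > 0 then k1 else k0)"

definition lam where "lam s = 1 + mix s"
definition mu where "mu s = \<beta> + mix s"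

text \<open>
  The speed at which the field of side \<open>s\<close> crosses the switching line towards side
  \<open>s\<close>. On the line it is an affine function of $T$ with nonzero slope
  $s\alpha(1-\beta)$, and serves as the coordinate there.
\<close>

definition outspeed where "outspeed s q = s * switch_deriv \<alpha> (linear_field \<beta> (mix s)) q"

definition node where "node s = (1 / lam s, \<beta> / mu s)"

definition depth where "depth s = - s * f (node s)"

definition flow where
  "flow s t q = (fst (node s) + (fst q - fst (node s)) * exp (- lam s * t),
                 snd (node s) + (snd q - snd (node s)) * exp (- mu s * t))"

text \<open>
  The amount by which $Z^+f$ exceeds $Z^-f$ on the switching line. A trajectory that arrives at
  the line with speed $v$ leaves it on the other side with speed $v$ plus the gain. Its sign is
  opposite to that of $\varepsilon$.
\<close>

definition gain where "gain = (k0 - k1) * \<epsilon>"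

lemma rates: "lam s > 0" "mu s > 0" "lam s \<noteq> mu s"
  using beta_pos k0_nonneg k0_less_k1 nondegenerate by (auto simp: lam_def mu_def mix_def)

text \<open>
  The two hypotheses on $\alpha$ say precisely that both equilibria are virtual: the node of
  each side lies on the opposite side of the switching line.
\<close>

lemma depth_pos:
  assumes "s \<in> {1, -1}"
  shows "depth s > 0"
proof -
  have *: "- (1 + k) * (\<beta> * (\<epsilon> - 1) + k * \<epsilon>) / (k + \<beta>) = (1 + k) * (\<beta> / (\<beta> + k) - \<epsilon>)" if "k \<ge> 0" for k
    using that beta_pos by (simp add: field_simps)
  have "\<alpha> / (1 + k0) < \<beta> / (\<beta> + k0) - \<epsilon>"
    using alpha_less *[of k0] k0_nonneg by (simp add: alpha_L_def field_simps)
  moreover have "\<alpha> / (1 + k1) > \<beta> / (\<beta> + k1) - \<epsilon>"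
    using alpha_greater *[of k1] k0_nonneg k0_less_k1 by (simp add: alpha_R_def field_simps)
  ultimately show ?thesis
    using assms by (auto simp: depth_def node_def switch_fun_def lam_def mu_def mix_def)
qed

lemma flow_0 [simp]: "flow s 0 q = q"
  by (simp add: flow_def)

lemma flow_flow: "flow s t (flow s r q) = flow s (t + r) q"
proof -
  have e: "exp (- c * (t + r)) = exp (- c * r) * exp (- c * t)" for c :: real
    by (simp add: distrib_left add.commute flip: exp_add)
  show ?thesis unfolding flow_def e by (simp add: mult.assoc)
qed

lemma flow_continuous [continuous_intros]:
  assumes "continuous_on A g" "continuous_on A h"
  shows "continuous_on A (\<lambda>t. flow s (g t) (h t))"
  unfolding flow_def using assms by (intro continuous_intros)

lemma f_continuous [continuous_intros]:
  assumes "continuous_on A g"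
  shows "continuous_on A (\<lambda>t. f (g t))"
  unfolding switch_fun_def case_prod_beta using assms by (intro continuous_intros)

lemma outspeed_eq:
  "outspeed s q = s * (\<beta> - mu s * snd q - \<alpha> + \<alpha> * lam s * fst q)"
  by (cases q) (simp add: outspeed_def switch_deriv_def linear_field_def lam_def mu_def algebra_simps)

lemma f_eq: "f q = snd q - \<alpha> * fst q - \<epsilon>"
  by (cases q) (simp add: switch_fun_def)

text \<open>
  Starting on the line with $x'(0)$ equal to the outward speed, $s f$ is the solution of the
  damped problem. The sign of \<open>t\<close> is free: negative times recover the flight from
  its landing point.
\<close>

lemma flow_switch:
  assumes "f q = 0" "t \<noteq> 0"
  shows "s * f (flow s t q) = (exp (- lam s * t) - exp (- mu s * t)) / (mu s - lam s)
           * (outspeed s q - depth s * launch (lam s) (mu s) t)"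
proof -
  define L M where "L = lam s" and "M = mu s"
  define A B where "A = exp (- M * t)" and "B = exp (- L * t)"
  have LM: "L \<noteq> M" "L > 0" "M > 0" using rates[of s] by (auto simp: L_def M_def)
  have "B - A \<noteq> 0" using LM assms by (auto simp: A_def B_def)
  \<comment> \<open>The deviations from the node in $S$ and, scaled by $\alpha$, in $T$.
    Being on the switching line means $u - v = h$.\<close>
  define u v where "u = snd q - \<beta> / M" and "v = \<alpha> * (fst q - 1 / L)"
  define h where "h = - (\<beta> / M - \<alpha> * (1 / L) - \<epsilon>)"
  have q: "u - v = h" using assms(1) by (simp add: u_def v_def h_def f_eq algebra_simps)
  have dep: "outspeed s q = s * (L * v - M * u)"
    using LM unfolding outspeed_eq L_def[symmetric] M_def[symmetric] by (simp add: u_def v_def field_simps)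
  have depth: "depth s = s * h" by (simp add: depth_def h_def f_eq node_def L_def M_def algebra_simps)
  have fl: "f (flow s t q) = u * A - v * B - h"
    unfolding f_eq flow_def node_def L_def[symmetric] M_def[symmetric]
    by (simp add: u_def v_def h_def A_def B_def algebra_simps)
  have launch: "launch L M t = (M * (1 - B) - L * (1 - A)) / (B - A)"
    by (simp add: launch_def A_def B_def)
  have "(B - A) / (M - L) * (outspeed s q - depth s * launch L M t)
     = s * ((B - A) * (L * v - M * u) - h * (M * (1 - B) - L * (1 - A))) / (M - L)"
    unfolding dep depth launch using \<open>B - A \<noteq> 0\<close> LM by (simp add: divide_simps) (simp add: algebra_simps)
  also have "(B - A) * (L * v - M * u) - h * (M * (1 - B) - L * (1 - A)) = (M - L) * (u * A - v * B - h)"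
    unfolding q[symmetric] by (simp add: algebra_simps)
  also have "s * \<dots> / (M - L) = s * f (flow s t q)" unfolding fl using LM by simp
  finally show ?thesis by (simp add: L_def M_def A_def B_def)
qed

lemma decay_quotient_pos:
  "t > 0 \<Longrightarrow> (exp (- lam s * t) - exp (- mu s * t)) / (mu s - lam s) > 0"
  "t < 0 \<Longrightarrow> (exp (- lam s * t) - exp (- mu s * t)) / (mu s - lam s) < 0"
  using rates[of s] by (auto simp: zero_less_divide_iff divide_less_0_iff not_less)

text \<open>
  The scalar problem is linear, so a node at depth $h$ only rescales speeds by $h$.
\<close>

definition duration where "duration s y = flight_time (lam s) (mu s) (y / depth s)"
definition impact where "impact s y = depth s * landing (lam s) (mu s) (y / depth s)"

lemma duration_pos: "s \<in> {1, -1} \<Longrightarrow> y > 0 \<Longrightarrow> duration s y > 0"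
  unfolding duration_def using depth_pos by (intro flight_time rates) auto

lemma duration_mono:
  assumes "s \<in> {1, -1}" "0 < y" "y \<le> z"
  shows "duration s y \<le> duration s z"
  using flight_time_strict_mono[OF rates, of "y / depth s" "z / depth s"] depth_pos[OF assms(1)] assms
  unfolding duration_def by (cases "y = z") (auto simp: divide_strict_right_mono intro!: less_imp_le)

lemma duration_isCont:
  assumes "s \<in> {1, -1}" "y > 0"
  shows "isCont (duration s) y"
  unfolding duration_def using depth_pos[OF assms(1)] assms
  by (intro isCont_o2[OF _ flight_time_isCont[OF rates]] continuous_intros) auto

lemma impact_pos: "s \<in> {1, -1} \<Longrightarrow> y > 0 \<Longrightarrow> impact s y > 0"
  unfolding impact_def using depth_pos by (intro mult_pos_pos landing_pos rates) auto

lemma impact_less: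
  assumes "s \<in> {1, -1}" "y > 0"
  shows "impact s y < y"
  using landing_less[OF rates, of "y / depth s"] depth_pos[OF assms(1)] assms(2)
  by (simp add: impact_def field_simps)

lemma impact_bounded:
  assumes "s \<in> {1, -1}" "y > 0"
  shows "impact s y < depth s * lam s"
  unfolding impact_def using landing_less_rate[OF rates, of "y / depth s"] depth_pos[OF assms(1)] assms(2)
  by simp

lemma impact_contracts:
  assumes "s \<in> {1, -1}" "y > 0" "z > 0" "y \<noteq> z"
  shows "\<bar>impact s y - impact s z\<bar> < \<bar>y - z\<bar>"
proof -
  have d: "depth s > 0" using depth_pos assms by blast
  have "\<bar>landing (lam s) (mu s) (y / depth s) - landing (lam s) (mu s) (z / depth s)\<bar> < \<bar>y / depth s - z / depth s\<bar>"
    using d assms by (intro landing_contracts[OF rates]) auto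
  then have "depth s * \<bar>landing (lam s) (mu s) (y / depth s) - landing (lam s) (mu s) (z / depth s)\<bar> < depth s * \<bar>y / depth s - z / depth s\<bar>"
    using d by simp
  also have "depth s * \<bar>y / depth s - z / depth s\<bar> = \<bar>y - z\<bar>"
    using d by (simp flip: diff_divide_distrib)
  also have "depth s * \<bar>landing (lam s) (mu s) (y / depth s) - landing (lam s) (mu s) (z / depth s)\<bar> = \<bar>impact s y - impact s z\<bar>"
    using d unfolding impact_def by (simp add: abs_mult flip: right_diff_distrib)
  finally show ?thesis .
qed

lemma flow_arc:
  assumes s: "s \<in> {1, -1}" and q: "f q = 0" and y: "outspeed s q > 0"
  defines "\<tau> \<equiv> duration s (outspeed s q)"
  shows "\<And>t. 0 < t \<Longrightarrow> t < \<tau> \<Longrightarrow> s * f (flow s t q) > 0"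
    and "f (flow s \<tau> q) = 0"
    and "outspeed s (flow s \<tau> q) = - impact s (outspeed s q)"
proof -
  let ?W = "launch (lam s) (mu s)" and ?u = "outspeed s q / depth s"
  have d: "depth s > 0" using depth_pos s by blast
  then have u: "?u > 0" using y by simp
  have t: "\<tau> > 0" "depth s * ?W \<tau> = outspeed s q"
    using flight_time[OF rates u] d by (auto simp: \<tau>_def duration_def)
  have s0: "s \<noteq> 0" using s by auto
  show "s * f (flow s t q) > 0" if "0 < t" "t < \<tau>" for t
  proof -
    have "?W t < ?u" using that launch_less_iff[OF rates that(1) u] by (simp add: \<tau>_def duration_def)
    then have "outspeed s q - depth s * ?W t > 0" using d by (simp add: field_simps)
    then show ?thesis using that decay_quotient_pos(1)[OF that(1), of s]
      unfolding flow_switch[OF q less_imp_neq[OF that(1), symmetric]] by (intro mult_pos_pos) auto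
  qed
  have "s * f (flow s \<tau> q) = 0" using t by (subst flow_switch[OF q]) auto
  then show z: "f (flow s \<tau> q) = 0" using s0 by simp
  \<comment> \<open>Flown backwards from the landing point, the arc returns to the line after the same time.
    This determines the landing speed.\<close>
  have "s * f (flow s (- \<tau>) (flow s \<tau> q)) = 0" by (simp add: flow_flow q)
  then have "outspeed s (flow s \<tau> q) - depth s * ?W (- \<tau>) = 0"
    using flow_switch[OF z, of "- \<tau>" s] t(1) decay_quotient_pos(2)[of "- \<tau>" s] by auto
  then show "outspeed s (flow s \<tau> q) = - impact s (outspeed s q)"
    by (simp add: impact_def landing_def \<tau>_def duration_def)
qed

text \<open>
  On the field of side \<open>s\<close>, a start on the line that does not point outwards leaves
  to the opposite side and never comes back, because the node lies there.
\<close>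

lemma inward_start:
  assumes s: "s \<in> {1, -1}" and q: "f q = 0" and y: "outspeed s q \<le> 0" and t: "t > 0"
  shows "s * f (flow s t q) < 0"
proof -
  have "depth s * launch (lam s) (mu s) t > 0"
    using depth_pos[OF s] launch_pos[OF rates t] by simp
  then show ?thesis
    using decay_quotient_pos(1)[OF t, of s] y t unfolding flow_switch[OF q less_imp_neq[OF t, symmetric]]
    by (intro mult_pos_neg) auto
qed

text \<open>
  From inside side \<open>s\<close> the flow tends to the node, which lies beyond the line, so
  it hits the line. It does so transversally: seen from the hitting point, the flow of time
  $-t/2$ is on side \<open>s\<close>, which by \<open>flow_switch\<close> forces a negative
  outward speed. Grazing is thereby excluded.
\<close>

lemma arrival:
  assumes s: "s \<in> {1, -1}" and p: "s * f p > 0"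
  obtains t where "t > 0" "f (flow s t p) = 0" "\<And>r. 0 \<le> r \<Longrightarrow> r < t \<Longrightarrow> s * f (flow s r p) > 0"
    "outspeed s (flow s t p) < 0"
proof -
  define F where "F = (\<lambda>t. s * f (flow s t p))"
  have F: "continuous_on A F" for A unfolding F_def by (intro continuous_intros)
  have "(F \<longlongrightarrow> s * ((snd (node s) + (snd p - snd (node s)) * 0) - \<alpha> * (fst (node s) + (fst p - fst (node s)) * 0) - \<epsilon>)) at_top"
    unfolding F_def f_eq flow_def fst_conv snd_conv by (intro tendsto_intros exp_decay_tendsto rates)
  then have "(F \<longlongrightarrow> - depth s) at_top" by (simp add: depth_def f_eq)
  then have "eventually (\<lambda>t. F t < 0) at_top" 
    by (rule order_tendstoD) (use depth_pos[OF s] in auto)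
  then have "eventually (\<lambda>t. F t < 0 \<and> t > 0) at_top"
    by (intro eventually_conj eventually_gt_at_top)
  then obtain b where b: "F b < 0" "b > 0"
    using eventually_happens'[OF trivial_limit_at_top_linorder] by blast
  have F0: "F 0 > 0" using p by (simp add: F_def)
  define Z where "Z = {0..b} \<inter> F -` {0}"
  have "compact Z" unfolding Z_def
    using F[of UNIV] by (intro compact_Int_closed compact_Icc continuous_closed_vimage)
      (auto simp: continuous_on_eq_continuous_at)
  moreover have "Z \<noteq> {}"
    using IVT2'[of F b 0 0] b p F by (force simp: F_def Z_def)
  ultimately obtain t where t: "t \<in> Z" "\<And>r. r \<in> Z \<Longrightarrow> t \<le> r"
    using compact_attains_inf by metis
  have s0: "s \<noteq> 0" using s by auto
  have t0: "t > 0" "F t = 0" using t(1) p by (auto simp: Z_def F_def le_less)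
  have pos: "F r > 0" if "0 \<le> r" "r < t" for r
  proof (rule ccontr)
    assume "\<not> F r > 0"
    then have "\<exists>z\<ge>0. z \<le> r \<and> F z = 0"
      using IVT2'[of F r 0 0] F0 that F by (auto simp: not_less)
    then obtain z where z: "0 \<le> z" "z \<le> r" "F z = 0" by blast
    moreover have "t \<le> b" using t(1) by (simp add: Z_def)
    ultimately have "z \<in> Z" using that by (simp add: Z_def)
    then show False using t(2) z that by fastforce
  qed
  have ft: "f (flow s t p) = 0" using t0 s0 by (simp add: F_def)
  have "F (t / 2) = s * f (flow s (- (t / 2)) (flow s t p))" by (simp add: F_def flow_flow)
  also have "\<dots> = (exp (- lam s * (- (t / 2))) - exp (- mu s * (- (t / 2)))) / (mu s - lam s)
           * (outspeed s (flow s t p) - depth s * launch (lam s) (mu s) (- (t / 2)))"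
    using t0 by (intro flow_switch ft) auto
  finally have prod: "F (t / 2) = \<dots>" .
  have "outspeed s (flow s t p) - depth s * launch (lam s) (mu s) (- (t / 2)) < 0"
  proof (rule ccontr)
    assume "\<not> ?thesis"
    then have "F (t / 2) \<le> 0"
      unfolding prod using decay_quotient_pos(2)[of "- (t / 2)" s] t0 by (intro mult_nonpos_nonneg) auto
    then show False using pos[of "t / 2"] t0 by auto
  qed
  moreover have "depth s * launch (lam s) (mu s) (- (t / 2)) < 0"
    using t0 by (intro mult_pos_neg depth_pos s launch_neg rates) auto
  ultimately show ?thesis using that t0 ft pos by (auto simp: F_def)
qed

text \<open>
  Both fields point to side \<open>s\<close> at \<open>q\<close>: the field of the opposite side
  does so with speed \<open>outspeed s q - gain\<close>.
\<close>

definition exits where "exits s q \<longleftrightarrow> f q = 0 \<and> outspeed s q > 0 \<and> outspeed s q > gain"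

lemma outspeed_other_side:
  assumes "s \<in> {1, -1}" "f q = 0"
  shows "outspeed (- s) q = gain - outspeed s q"
proof -
  have S: "snd q = \<alpha> * fst q + \<epsilon>" using assms(2) by (simp add: f_eq)
  show ?thesis using assms(1) 
    unfolding outspeed_eq S by (auto simp: lam_def mu_def mix_def gain_def algebra_simps)
qed

lemma crossing_point_iff:
  "crossing_point \<alpha> \<beta> k0 k1 \<epsilon> q \<longleftrightarrow> (\<exists>s\<in>{1, -1}. exits s q)"
proof (cases "f q = 0")
  case True
  have "crossing_point \<alpha> \<beta> k0 k1 \<epsilon> q \<longleftrightarrow> outspeed 1 q * outspeed (- 1) q < 0"
    using True by (simp add: crossing_point_def switch_line_def outspeed_def mix_def)
  also have "\<dots> \<longleftrightarrow> (\<exists>s\<in>{1, -1}. exits s q)"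
    using outspeed_other_side[of 1, OF _ True] True by (auto simp: exits_def mult_less_0_iff)
  finally show ?thesis .
qed (auto simp: crossing_point_def switch_line_def exits_def)

text \<open>
  The inverse of the coordinate \<open>outspeed s\<close> on the switching line.
\<close>

definition section_point where
  "section_point s y = (let T = (s * y - \<beta> + mu s * \<epsilon> + \<alpha>) / (\<alpha> * (1 - \<beta>)) in (T, \<alpha> * T + \<epsilon>))"

lemma f_section_point: "f (section_point s y) = 0"
  by (simp add: section_point_def f_eq Let_def)

lemma section_point_outspeed:
  assumes "s \<in> {1, -1}" "f q = 0"
  shows "section_point s (outspeed s q) = q"
proof -
  have S: "snd q = \<alpha> * fst q + \<epsilon>" using assms(2) by (simp add: f_eq)
  have "s * outspeed s q - \<beta> + mu s * \<epsilon> + \<alpha> = \<alpha> * (1 - \<beta>) * fst q"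
    using assms(1) unfolding outspeed_eq S by (auto simp: lam_def mu_def algebra_simps)
  then have "(s * outspeed s q - \<beta> + mu s * \<epsilon> + \<alpha>) / (\<alpha> * (1 - \<beta>)) = fst q"
    using nondegenerate by simp
  then show ?thesis by (simp add: section_point_def Let_def S prod_eq_iff)
qed

lemma outspeed_section_point:
  assumes "s \<in> {1, -1}"
  shows "outspeed s (section_point s y) = y"
proof -
  define T where "T = (s * y - \<beta> + mu s * \<epsilon> + \<alpha>) / (\<alpha> * (1 - \<beta>))"
  have "\<alpha> * (1 - \<beta>) * T = s * y - \<beta> + mu s * \<epsilon> + \<alpha>" using nondegenerate by (simp add: T_def)
  moreover have "outspeed s (section_point s y) = s * (\<beta> - mu s * \<epsilon> - \<alpha> + \<alpha> * (1 - \<beta>) * T)"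
    unfolding outspeed_eq section_point_def T_def[symmetric] Let_def by (simp add: lam_def mu_def algebra_simps)
  ultimately show ?thesis using assms by auto
qed

end


section \<open>Restricting and gluing crossing solutions\<close>

lemma crossing_solution_subset:
  assumes "crossing_solution \<alpha> \<beta> k0 k1 \<epsilon> I x" "J \<subseteq> I"
  shows "crossing_solution \<alpha> \<beta> k0 k1 \<epsilon> J x"
  unfolding crossing_solution_def
proof (intro conjI allI ballI impI)
  fix a b :: real
  show "finite {t \<in> J \<inter> {a..b}. x t \<in> switch_line \<alpha> \<epsilon>}"
    by (rule finite_subset[of _ "{t \<in> I \<inter> {a..b}. x t \<in> switch_line \<alpha> \<epsilon>}"])
      (use assms in \<open>auto simp: crossing_solution_def\<close>)
qed (use assms in \<open>auto simp: crossing_solution_def subset_iff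
       intro: continuous_on_subset has_vector_derivative_within_subset\<close>)

lemma crossing_solution_cong:
  assumes "crossing_solution \<alpha> \<beta> k0 k1 \<epsilon> I x" and eq: "\<And>t. t \<in> I \<Longrightarrow> y t = x t"
  shows "crossing_solution \<alpha> \<beta> k0 k1 \<epsilon> I y"
  unfolding crossing_solution_def
proof (intro conjI allI ballI impI)
  show "continuous_on I y"
    using assms by (simp add: crossing_solution_def cong: continuous_on_cong)
  show "(y has_vector_derivative welander_field \<alpha> \<beta> k0 k1 \<epsilon> (y t)) (at t within I)"
    if "t \<in> I" "y t \<notin> switch_line \<alpha> \<epsilon>" for t
    using assms that by (auto simp: crossing_solution_def intro: has_vector_derivative_transform)
  fix a b :: real
  have "{t \<in> I \<inter> {a..b}. y t \<in> switch_line \<alpha> \<epsilon>} = {t \<in> I \<inter> {a..b}. x t \<in> switch_line \<alpha> \<epsilon>}"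
    using eq by auto
  then show "finite {t \<in> I \<inter> {a..b}. y t \<in> switch_line \<alpha> \<epsilon>}"
    using assms(1) by (simp add: crossing_solution_def)
qed (use assms in \<open>auto simp: crossing_solution_def\<close>)

lemma crossing_solution_shift:
  assumes x: "crossing_solution \<alpha> \<beta> k0 k1 \<epsilon> I x" and J: "\<And>t. t \<in> J \<Longrightarrow> t + c \<in> I"
  shows "crossing_solution \<alpha> \<beta> k0 k1 \<epsilon> J (\<lambda>t. x (t + c))"
  unfolding crossing_solution_def
proof (intro conjI allI ballI impI)
  have sub: "(\<lambda>t. t + c) ` J \<subseteq> I" using J by auto
  show "continuous_on J (\<lambda>t. x (t + c))"
    by (rule continuous_on_compose2[of I x])
      (use x sub in \<open>auto simp: crossing_solution_def intro!: continuous_intros\<close>)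
  show "((\<lambda>t. x (t + c)) has_vector_derivative welander_field \<alpha> \<beta> k0 k1 \<epsilon> (x (t + c))) (at t within J)"
    if "t \<in> J" "x (t + c) \<notin> switch_line \<alpha> \<epsilon>" for t
  proof -
    have "(x has_vector_derivative welander_field \<alpha> \<beta> k0 k1 \<epsilon> (x (t + c))) (at (t + c) within (\<lambda>t. t + c) ` J)"
      using x that J sub by (auto simp: crossing_solution_def intro: has_vector_derivative_within_subset)
    moreover have "((\<lambda>t. t + c) has_vector_derivative 1) (at t within J)"
      by (auto intro!: derivative_eq_intros)
    ultimately show ?thesis
      using vector_diff_chain_within[of "\<lambda>t. t + c" 1 t J x] by (simp add: o_def)
  qed
  fix a b :: real
  have "{t \<in> J \<inter> {a..b}. x (t + c) \<in> switch_line \<alpha> \<epsilon>}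
      \<subseteq> (\<lambda>t. t - c) ` {t \<in> I \<inter> {a + c..b + c}. x t \<in> switch_line \<alpha> \<epsilon>}"
  proof
    fix t assume "t \<in> {t \<in> J \<inter> {a..b}. x (t + c) \<in> switch_line \<alpha> \<epsilon>}"
    then show "t \<in> (\<lambda>t. t - c) ` {t \<in> I \<inter> {a + c..b + c}. x t \<in> switch_line \<alpha> \<epsilon>}"
      using J[of t] by (intro image_eqI[of _ _ "t + c"]) auto
  qed
  then show "finite {t \<in> J \<inter> {a..b}. x (t + c) \<in> switch_line \<alpha> \<epsilon>}"
    using x by (rule_tac finite_subset) (auto simp: crossing_solution_def)
qed (use x J in \<open>auto simp: crossing_solution_def\<close>)

text \<open>
  At a common point of the two closed sets off the switching line, the one-sided derivatives
  agree because both are values of the same field.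
\<close>

lemma crossing_solution_Un:
  assumes x: "crossing_solution \<alpha> \<beta> k0 k1 \<epsilon> I x" "crossing_solution \<alpha> \<beta> k0 k1 \<epsilon> J x"
    and cl: "closed I" "closed J"
  shows "crossing_solution \<alpha> \<beta> k0 k1 \<epsilon> (I \<union> J) x"
  unfolding crossing_solution_def
proof (intro conjI allI ballI impI)
  show "continuous_on (I \<union> J) x"
    using assms by (intro continuous_on_closed_Un) (auto simp: crossing_solution_def)
  show "(x has_vector_derivative welander_field \<alpha> \<beta> k0 k1 \<epsilon> (x t)) (at t within I \<union> J)"
    if t: "t \<in> I \<union> J" and "x t \<notin> switch_line \<alpha> \<epsilon>" for t
  proof -
    have d: "t \<in> I \<Longrightarrow> (x has_vector_derivative welander_field \<alpha> \<beta> k0 k1 \<epsilon> (x t)) (at t within I)"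
       "t \<in> J \<Longrightarrow> (x has_vector_derivative welander_field \<alpha> \<beta> k0 k1 \<epsilon> (x t)) (at t within J)"
      using x that by (auto simp: crossing_solution_def)
    consider "t \<in> I" "t \<in> J" | "t \<in> I" "t \<notin> J" | "t \<notin> I" "t \<in> J" using t by blast
    then show ?thesis
    proof cases
      case 1
      then show ?thesis using d unfolding has_vector_derivative_def has_derivative_within
        by (simp add: at_within_union filterlim_sup)
    next
      case 2
      then have "at t within I \<union> J = at t within I"
        using cl by (intro at_within_nhd[of _ "- J"]) auto
      then show ?thesis using d 2 by simp
    next
      case 3
      then have "at t within I \<union> J = at t within J"
        using cl by (intro at_within_nhd[of _ "- I"]) auto
      then show ?thesis using d 3 by simp
    qed
  qed
  fix a b :: real
  have "{t \<in> (I \<union> J) \<inter> {a..b}. x t \<in> switch_line \<alpha> \<epsilon>}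
     = {t \<in> I \<inter> {a..b}. x t \<in> switch_line \<alpha> \<epsilon>} \<union> {t \<in> J \<inter> {a..b}. x t \<in> switch_line \<alpha> \<epsilon>}" by auto
  then show "finite {t \<in> (I \<union> J) \<inter> {a..b}. x t \<in> switch_line \<alpha> \<epsilon>}"
    using x by (simp add: crossing_solution_def)
qed (use x in \<open>auto simp: crossing_solution_def\<close>)

text \<open>
  All conditions on a crossing solution concern bounded time intervals.
\<close>

lemma crossing_solution_exhaust:
  assumes x: "\<And>r. crossing_solution \<alpha> \<beta> k0 k1 \<epsilon> (I \<inter> {- r..r}) x"
  shows "crossing_solution \<alpha> \<beta> k0 k1 \<epsilon> I x"
  unfolding crossing_solution_def
proof (intro conjI allI ballI impI)
  have within: "at t within I \<inter> {- (\<bar>t\<bar> + 1)..\<bar>t\<bar> + 1} = at t within I" for t :: real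
    by (rule at_within_nhd[of _ "{- (\<bar>t\<bar> + 1)<..<\<bar>t\<bar> + 1}"]) auto
  have mem: "t \<in> I \<inter> {- (\<bar>t\<bar> + 1)..\<bar>t\<bar> + 1}" if "t \<in> I" for t using that by auto
  show "continuous_on I x"
    unfolding continuous_on_eq_continuous_within
  proof
    fix t assume "t \<in> I"
    have "continuous_on (I \<inter> {- (\<bar>t\<bar> + 1)..\<bar>t\<bar> + 1}) x"
      using x by (simp only: crossing_solution_def)
    from this[unfolded continuous_on_eq_continuous_within, rule_format, OF mem[OF \<open>t \<in> I\<close>]]
    show "continuous (at t within I) x" by (simp only: within)
  qed
  fix t assume t: "t \<in> I"
  have xt: "crossing_solution \<alpha> \<beta> k0 k1 \<epsilon> (I \<inter> {- (\<bar>t\<bar> + 1)..\<bar>t\<bar> + 1}) x" by (rule x)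
  show "(x has_vector_derivative welander_field \<alpha> \<beta> k0 k1 \<epsilon> (x t)) (at t within I)"
    if "x t \<notin> switch_line \<alpha> \<epsilon>"
    using xt[unfolded crossing_solution_def, THEN conjunct2, THEN conjunct1, rule_format, OF mem[OF t] that]
    by (simp only: within)
  show "crossing_point \<alpha> \<beta> k0 k1 \<epsilon> (x t)" if "x t \<in> switch_line \<alpha> \<epsilon>"
    using xt mem[OF t] that by (simp add: crossing_solution_def)
next
  fix a b :: real
  define r where "r = max \<bar>a\<bar> \<bar>b\<bar>"
  have "{t \<in> I \<inter> {a..b}. x t \<in> switch_line \<alpha> \<epsilon>} = {t \<in> (I \<inter> {- r..r}) \<inter> {a..b}. x t \<in> switch_line \<alpha> \<epsilon>}"
    by (auto simp: r_def)
  then show "finite {t \<in> I \<inter> {a..b}. x t \<in> switch_line \<alpha> \<epsilon>}"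
    using x[of r] by (simp add: crossing_solution_def)
qed

text \<open>
  The lower bound \<open>c\<close> on the lengths of the pieces ensures that together they fill
  a half-line.
\<close>

lemma crossing_solution_concatenate:
  fixes t :: "nat \<Rightarrow> real"
  assumes x: "\<And>n. crossing_solution \<alpha> \<beta> k0 k1 \<epsilon> {t n..t (Suc n)} (piece n)"
    and glue: "\<And>n. piece (Suc n) (t (Suc n)) = piece n (t (Suc n))"
    and step: "\<And>n. t n + c \<le> t (Suc n)" and c: "c > 0"
  obtains X where "crossing_solution \<alpha> \<beta> k0 k1 \<epsilon> {t 0..} X" "X (t 0) = piece 0 (t 0)"
proof -
  have less: "t n < t (Suc n)" for n using step[of n] c by linarith
  have mono: "t m \<le> t n" if "m \<le> n" for m n
    using less by (intro lift_Suc_mono_le[of t, OF _ that] less_imp_le)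
  have lin: "t n \<ge> t 0 + n * c" for n
  proof (induction n)
    case (Suc n)
    then show ?case using step[of n] by (simp add: algebra_simps)
  qed simp
  \<comment> \<open>The index of the piece in charge at time $r$. At a gluing time this is the later one of the two.\<close>
  define N where "N = (\<lambda>r. LEAST n. r < t (Suc n))"
  define X where "X = (\<lambda>r. piece (N r) r)"
  have N: "N r = n" if "t n \<le> r" "r < t (Suc n)" for n r
    unfolding N_def
  proof (rule Least_equality)
    show "n \<le> m" if "r < t (Suc m)" for m
      using mono[of "Suc m" n] that \<open>t n \<le> r\<close> by (meson leD not_less_eq_eq order_trans)
  qed (rule that)
  have X: "X r = piece n r" if "r \<in> {t n..t (Suc n)}" for n r
  proof (cases "r = t (Suc n)")
    case True
    then have "N r = Suc n" using less[of "Suc n"] by (intro N) auto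
    then show ?thesis using glue[of n] True by (simp add: X_def)
  next
    case False
    then show ?thesis using that N[of n r] by (simp add: X_def)
  qed
  have fin: "crossing_solution \<alpha> \<beta> k0 k1 \<epsilon> {t 0..t (Suc n)} X" for n
  proof (induction n)
    case 0
    show ?case by (rule crossing_solution_cong[OF x[of 0]]) (use X[of _ 0] in auto)
  next
    case (Suc n)
    have "crossing_solution \<alpha> \<beta> k0 k1 \<epsilon> {t (Suc n)..t (Suc (Suc n))} X"
      by (rule crossing_solution_cong[OF x[of "Suc n"]]) (use X[of _ "Suc n"] in auto)
    from crossing_solution_Un[OF Suc this] show ?case
      using mono[of 0 "Suc n"] less[of "Suc n"] by (simp add: ivl_disj_un_two_touch)
  qed
  have "crossing_solution \<alpha> \<beta> k0 k1 \<epsilon> {t 0..} X"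
  proof (rule crossing_solution_exhaust)
    fix r
    obtain n :: nat where "(r - t 0) / c < n" using reals_Archimedean2 by blast
    then have "r < t 0 + n * c" using c by (simp add: field_simps)
    then have "r \<le> t (Suc n)" using lin[of n] less[of n] by linarith
    then show "crossing_solution \<alpha> \<beta> k0 k1 \<epsilon> ({t 0..} \<inter> {- r..r}) X"
      by (intro crossing_solution_subset[OF fin[of n]]) auto
  qed
  moreover have "X (t 0) = piece 0 (t 0)" using X[of "t 0" 0] less[of 0] by simp
  ultimately show ?thesis using that by blast
qed

section \<open>Crossing solutions follow the linear flows\<close>

context welander
begin

abbreviation sol where "sol \<equiv> crossing_solution \<alpha> \<beta> k0 k1 \<epsilon>"
abbreviation crossing where "crossing \<equiv> crossing_point \<alpha> \<beta> k0 k1 \<epsilon>"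

lemma switch_line_iff: "p \<in> switch_line \<alpha> \<epsilon> \<longleftrightarrow> f p = 0"
  by (simp add: switch_line_def)

lemma welander_field_side:
  assumes "s \<in> {1, -1}" "s * f p > 0"
  shows "welander_field \<alpha> \<beta> k0 k1 \<epsilon> p
     = (lam s * (fst (node s) - fst p), mu s * (snd (node s) - snd p))"
proof -
  have "mixing k0 k1 \<epsilon> (- \<alpha> * fst p + snd p) = mix s"
    using assms by (auto simp: mixing_def mix_def f_eq)
  then show ?thesis using rates[of s]
    by (cases p) (simp add: welander_field_def linear_field_def node_def right_diff_distrib, simp add: lam_def mu_def algebra_simps)
qed

text \<open>
  Uniqueness for $g' = c(e-g)$. The equation is only assumed in the open interval, since a
  crossing solution has no prescribed derivative at its gluing times.
\<close>

lemma exponential_decay_unique: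
  fixes g :: "real \<Rightarrow> real"
  assumes "a \<le> b" "continuous_on {a..b} g"
    and d: "\<And>t. a < t \<Longrightarrow> t < b \<Longrightarrow> (g has_real_derivative c * (e - g t)) (at t)"
    and t: "t \<in> {a..b}"
  shows "g t = e + (g a - e) * exp (- c * (t - a))"
proof -
  define h where "h = (\<lambda>t. (g t - e) * exp (c * (t - a)))"
  have "h t = h a"
  proof (cases "a < t")
    case True
    show ?thesis
    proof (rule DERIV_isconst_end[OF True])
      show "continuous_on {a..t} h" unfolding h_def
        by (intro continuous_intros continuous_on_subset[OF assms(2)]) (use t in auto)
      show "(h has_real_derivative 0) (at r)" if "a < r" "r < t" for r
      proof -
        have 1: "((\<lambda>t. exp (c * (t - a))) has_real_derivative c * exp (c * (r - a))) (at r)"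
          by (auto intro!: derivative_eq_intros)
        have 2: "((\<lambda>t. g t - e) has_real_derivative c * (e - g r)) (at r)"
          using d[of r] that t by (auto intro!: DERIV_diff[where E = 0, simplified])
        from DERIV_mult[OF 2 1] show ?thesis unfolding h_def by (simp add: algebra_simps)
      qed
    qed
  qed (use t in auto)
  then have "(g t - e) * (exp (c * (t - a)) * exp (- c * (t - a))) = (g a - e) * exp (- c * (t - a))"
    by (simp add: h_def)
  also have "exp (c * (t - a)) * exp (- c * (t - a)) = 1" by (simp flip: exp_add)
  finally show ?thesis by simp
qed

lemma sol_on_side:
  assumes x: "sol I x" and I: "{a..b} \<subseteq> I" and s: "s \<in> {1, -1}"
    and side: "\<And>t. a < t \<Longrightarrow> t < b \<Longrightarrow> s * f (x t) > 0" and t: "t \<in> {a..b}"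
  shows "x t = flow s (t - a) (x a)"
proof -
  have d: "(x has_vector_derivative (lam s * (fst (node s) - fst (x t)), mu s * (snd (node s) - snd (x t)))) (at t)"
    if "a < t" "t < b" for t
  proof -
    have "t \<in> interior I" using that I interior_mono[of "{a..b}" I] by auto
    then have "at t within I = at t" by (rule at_within_interior)
    moreover have "t \<in> I" using that I by auto
    moreover have "x t \<notin> switch_line \<alpha> \<epsilon>" using side[OF that] by (auto simp: switch_line_iff)
    ultimately show ?thesis using x welander_field_side[OF s side[OF that]]
      by (auto simp: crossing_solution_def)
  qed
  have c: "continuous_on {a..b} x"
    using x I by (auto simp: crossing_solution_def intro: continuous_on_subset)
  have "fst (x t) = fst (node s) + (fst (x a) - fst (node s)) * exp (- lam s * (t - a))"
    using t by (intro exponential_decay_unique[of a b "\<lambda>t. fst (x t)"] continuous_intros c)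
      (auto dest: bounded_linear.has_vector_derivative[OF bounded_linear_fst d]
         simp: has_real_derivative_iff_has_vector_derivative)
  moreover have "snd (x t) = snd (node s) + (snd (x a) - snd (node s)) * exp (- mu s * (t - a))"
    using t by (intro exponential_decay_unique[of a b "\<lambda>t. snd (x t)"] continuous_intros c)
      (auto dest: bounded_linear.has_vector_derivative[OF bounded_linear_snd d]
         simp: has_real_derivative_iff_has_vector_derivative)
  ultimately show ?thesis by (simp add: flow_def prod_eq_iff)
qed

text \<open>
  A crossing solution that does not start into the opposite side must follow the flow of side
  \<open>s\<close> for as long as this flow remains there. Up to the next time on the switching
  line, which exists by finiteness, the solution stays on one side and hence on one linear flow.
  That next time cannot come before the flow itself reaches the line.
\<close>

lemma sol_follows_flow:
  assumes x: "sol I x" and I: "{a..a + \<tau>} \<subseteq> I" and s: "s \<in> {1, -1}" and \<tau>: "\<tau> > 0"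
    and stays: "\<And>r. 0 < r \<Longrightarrow> r < \<tau> \<Longrightarrow> s * f (flow s r (x a)) > 0"
    and enters: "\<And>b. a < b \<Longrightarrow> b \<le> a + \<tau> \<Longrightarrow> \<exists>t. a < t \<and> t < b \<and> - s * f (x t) \<le> 0"
    and r: "r \<in> {0..\<tau>}"
  shows "x (a + r) = flow s r (x a)"
proof -
  have c: "continuous_on {a..a + \<tau>} x"
    using x I by (auto simp: crossing_solution_def intro: continuous_on_subset)
  define A where "A = {t \<in> I \<inter> {a..a + \<tau>}. x t \<in> switch_line \<alpha> \<epsilon>} - {a}"
  have A: "finite A" "\<And>t. t \<in> A \<longleftrightarrow> a < t \<and> t \<le> a + \<tau> \<and> f (x t) = 0"
    using x I by (auto simp: A_def crossing_solution_def switch_line_iff)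
  \<comment> \<open>The next time on the switching line, capped at the end of the interval.\<close>
  define b where "b = Min (insert (a + \<tau>) A)"
  have b: "a < b" "b \<le> a + \<tau>" "\<And>t. t \<in> A \<Longrightarrow> b \<le> t"
    using A \<tau> by (auto simp: b_def)
  have s1: "s = 1 \<or> s = - 1" using s by auto
  have nz: "f (x t) \<noteq> 0" if "a < t" "t < b" for t
    using b A(2)[of t] that by force
  obtain t0 where t0: "a < t0" "t0 < b" "s * f (x t0) > 0"
    using enters[OF b(1,2)] nz s1 by (metis less_eq_real_def minus_mult_left mult_1 neg_0_less_iff_less neg_le_0_iff_le no_zero_divisors zero_neq_neg_one zero_neq_one)
  have pos: "s * f (x t) > 0" if "a < t" "t < b" for t
  proof (rule ccontr)
    assume neg: "\<not> ?thesis"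
    have "connected ((\<lambda>t. s * f (x t)) ` {a<..<b})"
      by (intro connected_continuous_image continuous_intros continuous_on_subset[OF c]) (use b in auto)
    then have "0 \<in> (\<lambda>t. s * f (x t)) ` {a<..<b}"
      by (rule connectedD_interval[of _ "s * f (x t)" "s * f (x t0)"]) (use neg t0 that in auto)
    then show False using nz s1 by auto
  qed
  have flow: "x t = flow s (t - a) (x a)" if "t \<in> {a..b}" for t
    using that b I by (intro sol_on_side[OF x _ s pos]) auto
  have "b = a + \<tau>"
  proof (rule ccontr)
    assume "b \<noteq> a + \<tau>"
    moreover have "b \<in> insert (a + \<tau>) A" unfolding b_def using A(1) by (intro Min_in) auto
    ultimately have "f (x b) = 0" "b < a + \<tau>" using A(2)[of b] b(2) by auto
    moreover have "x b = flow s (b - a) (x a)" using b(1) by (intro flow) auto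
    ultimately show False using stays[of "b - a"] b(1) by auto
  qed
  then show ?thesis using flow[of "a + r"] r by auto
qed

text \<open>
  At a crossing point the solution has no choice: if it entered the side opposite to
  \<open>s\<close>, it would follow that side's flow, which \<open>inward_start\<close> sends to
  side \<open>s\<close>.
\<close>

lemma sol_after_exit:
  assumes x: "sol I x" and s: "s \<in> {1, -1}" and q: "exits s (x a)"
    and I: "{a..a + duration s (outspeed s (x a))} \<subseteq> I"
    and r: "r \<in> {0..duration s (outspeed s (x a))}"
  shows "x (a + r) = flow s r (x a)"
proof (rule sol_follows_flow[OF x I s _ _ _ r])
  have y: "f (x a) = 0" "outspeed s (x a) > 0" "outspeed (- s) (x a) < 0"
    using q outspeed_other_side[OF s] by (auto simp: exits_def)
  show "duration s (outspeed s (x a)) > 0" using duration_pos s y by blast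
  show "s * f (flow s r (x a)) > 0" if "0 < r" "r < duration s (outspeed s (x a))" for r
    using flow_arc(1)[OF s y(1,2)] that by blast
  have s': "- s \<in> {1, -1}" using s by auto
  show "\<exists>t. a < t \<and> t < b \<and> - s * f (x t) \<le> 0" if b: "a < b" "b \<le> a + duration s (outspeed s (x a))" for b
  proof (rule ccontr)
    assume "\<not> ?thesis"
    then have pos: "- s * f (x t) > 0" if "a < t" "t < b" for t using that by force
    define t where "t = (a + b) / 2"
    have t: "a < t" "t < b" using b by (auto simp: t_def)
    have "x t = flow (- s) (t - a) (x a)"
      by (rule sol_on_side[OF x _ s' pos]) (use t b I in auto)
    then show False using inward_start[OF s' y(1), of "t - a"] y(3) t pos[OF t] by simp
  qed
qed

lemma arc_sol:
  assumes s: "s \<in> {1, -1}" and inside: "\<And>r. 0 < r \<Longrightarrow> r < \<tau> \<Longrightarrow> s * f (flow s r q) > 0"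
    and ends: "s * f q > 0 \<or> crossing q" "crossing (flow s \<tau> q)"
  shows "sol {0..\<tau>} (\<lambda>t. flow s t q)"
proof -
  have cr: "f p = 0" if "crossing p" for p using that by (simp add: crossing_point_def switch_line_iff)
  have dich: "s * f (flow s t q) > 0 \<or> crossing (flow s t q) \<and> t \<in> {0, \<tau>}" if "t \<in> {0..\<tau>}" for t
    using inside[of t] ends that by (cases "t = 0"; cases "t = \<tau>") auto
  show ?thesis
    unfolding crossing_solution_def switch_line_iff
  proof (intro conjI ballI allI impI)
    show "continuous_on {0..\<tau>} (\<lambda>t. flow s t q)" by (intro continuous_intros)
    show "((\<lambda>t. flow s t q) has_vector_derivative welander_field \<alpha> \<beta> k0 k1 \<epsilon> (flow s t q)) (at t within {0..\<tau>})"
      if "t \<in> {0..\<tau>}" "f (flow s t q) \<noteq> 0" for t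
    proof -
      have "s * f (flow s t q) > 0" using dich[OF that(1)] cr that(2) by blast
      then show ?thesis unfolding welander_field_side[OF s \<open>s * f (flow s t q) > 0\<close>]
        unfolding flow_def fst_conv snd_conv has_real_derivative_iff_has_vector_derivative
        by (intro has_vector_derivative_Pair)
          (auto intro!: derivative_eq_intros simp flip: has_real_derivative_iff_has_vector_derivative)
    qed
    show "crossing (flow s t q)" if "t \<in> {0..\<tau>}" "f (flow s t q) = 0" for t
      using dich[OF that(1)] that(2) by auto
    show "finite {t \<in> {0..\<tau>} \<inter> {a..b}. f (flow s t q) = 0}" for a b
      by (rule finite_subset[of _ "{0, \<tau>}"]) (use dich in force)+
  qed
qed

end


section \<open>Half turns and the return map\<close>

context welander
begin

lemma other_side: "s \<in> {1, -1} \<Longrightarrow> - s \<in> {1, -1}" for s :: real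
  by auto

lemma exits_other_side:
  assumes "s \<in> {1, -1}" "crossing q" "outspeed s q < 0"
  shows "exits (- s) q"
  using assms unfolding crossing_point_iff exits_def by auto

text \<open>
  One flight over side \<open>s\<close>, in the coordinate \<open>outspeed\<close>: the landing
  speed is that of the damped problem, and changing to the other field adds the gain. The
  landing point is a crossing point because the solution is a crossing solution; for a negative
  gain this is a restriction on the solution.
\<close>

lemma half_turn:
  assumes x: "sol I x" and s: "s \<in> {1, -1}" and q: "exits s (x a)" and I: "{a..} \<subseteq> I"
  defines "b \<equiv> a + duration s (outspeed s (x a))"
  shows "a < b" "exits (- s) (x b)" "outspeed (- s) (x b) = impact s (outspeed s (x a)) + gain"
proof -
  let ?y = "outspeed s (x a)"
  have y: "f (x a) = 0" "?y > 0" using q by (auto simp: exits_def)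
  show ab: "a < b" using duration_pos[OF s y(2)] by (simp add: b_def)
  have xb: "x b = flow s (duration s ?y) (x a)"
    unfolding b_def by (rule sol_after_exit[OF x s q]) (use I duration_pos[OF s y(2)] in auto)
  have z: "f (x b) = 0" "outspeed s (x b) = - impact s ?y"
    using flow_arc(2,3)[OF s y] xb by auto
  have "b \<in> I" using I ab by auto
  then have "crossing (x b)"
    using x z(1) by (simp add: crossing_solution_def switch_line_iff)
  then show "exits (- s) (x b)"
    using z(2) impact_pos[OF s y(2)] by (intro exits_other_side s) auto
  show "outspeed (- s) (x b) = impact s ?y + gain"
    using outspeed_other_side[OF s z(1)] z(2) by simp
qed

text \<open>
  A crossing periodic orbit meets the line in finitely many points, and a half turn leads from
  one of them to another. For every quantity \<open>v\<close> there is therefore a crossing at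
  which a half turn does not decrease it. This replaces iterating the return map along the
  orbit.
\<close>

lemma periodic_orbit_minimal_crossing:
  fixes v :: "real \<Rightarrow> real \<times> real \<Rightarrow> real"
  assumes "crossing_periodic_orbit \<alpha> \<beta> k0 k1 \<epsilon> \<Gamma>"
  obtains x P t s where "P > 0" "\<And>t. x (t + P) = x t" "sol UNIV x" "\<Gamma> = range x"
    "s \<in> {1, -1}" "exits s (x t)"
    "v s (x t) \<le> v (- s) (x (t + duration s (outspeed s (x t))))"
proof -
  from assms obtain x P where x: "P > 0" "\<And>t. x (t + P) = x t" "sol UNIV x" "\<Gamma> = range x"
    and fin: "\<Gamma> \<inter> switch_line \<alpha> \<epsilon> \<noteq> {}" "finite (\<Gamma> \<inter> switch_line \<alpha> \<epsilon>)"
    unfolding crossing_periodic_orbit_def by blast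
  define A where "A = {(s, q). s \<in> {1, -1} \<and> q \<in> \<Gamma> \<inter> switch_line \<alpha> \<epsilon> \<and> exits s q}"
  have "A \<subseteq> {1, -1} \<times> (\<Gamma> \<inter> switch_line \<alpha> \<epsilon>)" by (auto simp: A_def)
  then have "finite A" using fin(2) by (rule_tac finite_subset) auto
  moreover have "A \<noteq> {}"
  proof -
    obtain t where "x t \<in> switch_line \<alpha> \<epsilon>" using fin(1) x(4) by auto
    moreover from this have "crossing (x t)" using x(3) by (auto simp: crossing_solution_def)
    then obtain s where "s \<in> {1, -1}" "exits s (x t)" unfolding crossing_point_iff by blast
    ultimately have "(s, x t) \<in> A" using x(4) by (auto simp: A_def)
    then show ?thesis by blast
  qed
  ultimately obtain m where m: "m \<in> A" "\<And>n. n \<in> A \<Longrightarrow> case_prod v m \<le> case_prod v n"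
    using arg_min_if_finite[of A "case_prod v"] by (metis not_less)
  obtain s t where st: "m = (s, x t)" "s \<in> {1, -1}" "exits s (x t)"
    using m(1) x(4) by (auto simp: A_def)
  define b where "b = t + duration s (outspeed s (x t))"
  have "exits (- s) (x b)" unfolding b_def by (rule half_turn[OF x(3) st(2,3)]) simp
  then have "(- s, x b) \<in> A"
    using x(4) st(2) by (auto simp: A_def exits_def switch_line_iff)
  from m(2)[OF this] show ?thesis using that[OF x st(2,3)] st(1) by (simp add: b_def)
qed

text \<open>
  When $\varepsilon \ge 0$, the damping lowers the speed in each half turn and the gain does not
  raise it, which is incompatible with a crossing of minimal speed.
\<close>

lemma no_crossing_periodic_orbit:
  assumes "\<epsilon> \<ge> 0"
  shows "\<not> crossing_periodic_orbit \<alpha> \<beta> k0 k1 \<epsilon> \<Gamma>"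
proof
  assume "crossing_periodic_orbit \<alpha> \<beta> k0 k1 \<epsilon> \<Gamma>"
  then show False
  proof (rule periodic_orbit_minimal_crossing[where v = outspeed])
    fix x P t s
    assume x: "sol UNIV x" and s: "s \<in> {1, -1}" "exits s (x t)"
      and le: "outspeed s (x t) \<le> outspeed (- s) (x (t + duration s (outspeed s (x t))))"
    have "gain \<le> 0" using assms k0_less_k1 by (simp add: gain_def mult_le_0_iff)
    moreover have "outspeed s (x t) > 0" using s by (simp add: exits_def)
    ultimately show False
      using le half_turn(3)[OF x s] impact_less[OF s(1), of "outspeed s (x t)"] by simp
  qed
qed

lemma impact_continuous_on:
  assumes "s \<in> {1, -1}"
  shows "continuous_on {0<..} (impact s)"
proof -
  have "1-lipschitz_on {0<..} (impact s)"
  proof (rule lipschitz_onI)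
    fix y z :: real assume "y \<in> {0<..}" "z \<in> {0<..}"
    then show "dist (impact s y) (impact s z) \<le> 1 * dist y z"
      using impact_contracts[OF assms, of y z] by (cases "y = z") (auto simp: dist_real_def)
  qed simp
  then show ?thesis by (rule lipschitz_on_continuous_on)
qed

text \<open>
  The full turn raises the smallest admissible speed \<open>gain\<close>, and its values are
  bounded because landing speeds are bounded. The intermediate value theorem gives a fixed
  point.
\<close>

lemma return_fixed_point:
  assumes "gain > 0"
  obtains y z where "y > gain" "z > gain" "z = impact 1 y + gain" "y = impact (- 1) z + gain"
proof -
  define R where "R = (\<lambda>y. impact (- 1) (impact 1 y + gain) + gain)"
  define b where "b = gain + depth (- 1) * lam (- 1)"
  have gb: "gain < b" using depth_pos[of "- 1"] rates[of "- 1"] by (simp add: b_def)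
  have p: "impact 1 y > 0" if "y \<ge> gain" for y using impact_pos[of 1 y] that assms by simp
  have "continuous_on {gain..b} (\<lambda>y. impact (- 1) (impact 1 y + gain))"
    by (rule continuous_on_compose2[OF impact_continuous_on])
      (use p assms in \<open>auto intro!: continuous_intros continuous_on_subset[OF impact_continuous_on] add_pos_pos\<close>)
  then have "continuous_on {gain..b} (\<lambda>y. R y - y)"
    unfolding R_def by (intro continuous_intros)
  moreover have "R gain - gain \<ge> 0" 
    unfolding R_def using impact_pos[of "- 1" "impact 1 gain + gain"] p[of gain] assms by simp
  moreover have "R b - b \<le> 0"
    unfolding R_def using impact_bounded[of "- 1" "impact 1 b + gain"] p[of b] gb assms by (simp add: b_def)
  ultimately have "\<exists>y\<ge>gain. y \<le> b \<and> R y - y = 0"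
    using IVT2'[of "\<lambda>y. R y - y" b 0 gain] gb by auto
  then obtain y where y: "y \<ge> gain" "R y = y" by auto
  define z where "z = impact 1 y + gain"
  have z: "z > gain" using p[OF y(1)] by (simp add: z_def)
  have "y = impact (- 1) z + gain" using y(2) by (simp add: R_def z_def)
  moreover from this have "y > gain" using impact_pos[of "- 1" z] z assms by simp
  ultimately show ?thesis using that z z_def by blast
qed

lemma dist_le_abs: "dist p q \<le> \<bar>fst p - fst q\<bar> + \<bar>snd p - snd q\<bar>" for p q :: "real \<times> real"
  unfolding dist_prod_def dist_real_def using sqrt_sum_squares_le_sum_abs[of "fst p - fst q" "snd p - snd q"] by simp

text \<open>
  The two coordinates decay independently towards the node, so each flow shrinks distances.
\<close>

lemma flow_nonexpansive:
  assumes "t \<ge> 0"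
  shows "dist (flow s t p) (flow s t q) \<le> dist p q"
proof -
  have *: "(dist (c + (a - c) * exp (- l * t)) (c + (b - c) * exp (- l * t)))\<^sup>2 \<le> (dist a b)\<^sup>2"
    if "l > 0" for a b c l :: real
  proof -
    have "dist (c + (a - c) * exp (- l * t)) (c + (b - c) * exp (- l * t)) = \<bar>(a - b) * exp (- l * t)\<bar>"
      by (simp add: dist_real_def algebra_simps)
    also have "\<dots> = \<bar>a - b\<bar> * exp (- l * t)" by (simp add: abs_mult)
    also have "\<dots> \<le> \<bar>a - b\<bar> * 1" using that assms by (intro mult_left_mono) auto
    finally show ?thesis by (intro power_mono) (auto simp: dist_real_def)
  qed
  show ?thesis unfolding dist_prod_def flow_def fst_conv snd_conv
    by (intro real_sqrt_le_mono add_mono * rates)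
qed

lemma flow_time_lipschitz:
  assumes "t \<ge> 0" "r \<ge> 0"
  shows "dist (flow s t q) (flow s r q)
    \<le> (lam s * \<bar>fst q - fst (node s)\<bar> + mu s * \<bar>snd q - snd (node s)\<bar>) * \<bar>t - r\<bar>"
proof -
  have e: "\<bar>exp (- l * t) - exp (- l * r)\<bar> \<le> l * \<bar>t - r\<bar>" if l: "l > 0" and t: "t \<ge> 0" "r \<ge> 0" for l t r :: real
  proof -
    \<comment> \<open>The factor $e^{-lr}$ is at most $1$, and $1 - e^{-x} \le x$.\<close>
    have *: "exp (- l * r) - exp (- l * t) \<le> l * (t - r)" if "r \<le> t" "r \<ge> 0" for r t
    proof -
      have "exp (- l * r) - exp (- l * t) = exp (- l * r) * (1 - exp (- l * (t - r)))"
        by (simp add: right_diff_distrib flip: exp_add)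
      also have "\<dots> \<le> 1 * (1 - exp (- l * (t - r)))"
        using l that by (intro mult_right_mono) auto
      also have "\<dots> \<le> l * (t - r)" using exp_ge_add_one_self[of "- l * (t - r)"] by simp
      finally show ?thesis .
    qed
    have "exp (- l * max t r) \<le> exp (- l * min t r)" using l by simp
    then show ?thesis using *[of r t] *[of t r] t by (cases "r \<le> t") (auto simp: abs_if)
  qed
  have c: "\<bar>(n + (a - n) * exp (- l * t)) - (n + (a - n) * exp (- l * r))\<bar> \<le> l * \<bar>a - n\<bar> * \<bar>t - r\<bar>"
    if "l > 0" for l a n :: real
  proof -
    have "\<bar>(n + (a - n) * exp (- l * t)) - (n + (a - n) * exp (- l * r))\<bar> = \<bar>a - n\<bar> * \<bar>exp (- l * t) - exp (- l * r)\<bar>"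
      by (simp add: abs_mult flip: right_diff_distrib)
    also have "\<dots> \<le> \<bar>a - n\<bar> * (l * \<bar>t - r\<bar>)" by (intro mult_left_mono e that assms) auto
    finally show ?thesis by (simp add: mult_ac)
  qed
  have "dist (flow s t q) (flow s r q) \<le> lam s * \<bar>fst q - fst (node s)\<bar> * \<bar>t - r\<bar> + mu s * \<bar>snd q - snd (node s)\<bar> * \<bar>t - r\<bar>"
    by (rule order_trans[OF dist_le_abs], unfold flow_def fst_conv snd_conv, intro add_mono c rates)
  then show ?thesis by (simp add: distrib_right)
qed

end

section \<open>Solutions when the gain is positive\<close>

text \<open>
  The positive gain corresponds to $\varepsilon<0$, and \<open>star\<close> is a cycle of the
  half-turn maps: the speeds at which the periodic orbit will enter the two sides.
\<close>

locale welander_cycle = welander +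
  fixes star :: "real \<Rightarrow> real"
  assumes gain_pos: "gain > 0"
    and star_greater: "s \<in> {1, -1} \<Longrightarrow> star s > gain"
    and star_other_side: "s \<in> {1, -1} \<Longrightarrow> star (- s) = impact s (star s) + gain"
begin

lemma exits_iff: "exits s q \<longleftrightarrow> f q = 0 \<and> outspeed s q > gain"
  using gain_pos by (auto simp: exits_def)

lemma star_pos: "s \<in> {1, -1} \<Longrightarrow> star s > 0"
  using star_greater[of s] gain_pos by simp

text \<open>
  Every exit speed exceeds the gain, and faster flights last longer, so all flights last at
  least this long. Statements for all future times can therefore be proved by induction on the
  number of elapsed units \<open>min_duration\<close>.
\<close>

definition min_duration where "min_duration = min (duration 1 gain) (duration (- 1) gain)"

lemma min_duration_pos: "min_duration > 0"
  using duration_pos gain_pos by (auto simp: min_duration_def)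

lemma min_duration_le:
  assumes "s \<in> {1, -1}" "exits s q"
  shows "min_duration \<le> duration s (outspeed s q)"
proof -
  have "duration s gain \<le> duration s (outspeed s q)"
    using assms gain_pos by (intro duration_mono) (auto simp: exits_def)
  then show ?thesis using assms(1) by (auto simp: min_duration_def)
qed

lemma arrival_exits:
  assumes "s \<in> {1, -1}" "f q = 0" "outspeed s q < 0"
  shows "exits (- s) q"
  using outspeed_other_side[OF assms(1,2)] assms gain_pos by (simp add: exits_def)

text \<open>
  A positive gain carries every landing point across, whatever its landing speed. The flights
  can thus be chained without end, alternating between the two sides.
\<close>

lemma sol_from_exit:
  assumes s: "s \<in> {1, -1}" and q: "exits s q"
  obtains X where "sol {0..} X" "X 0 = q"
proof -
  define side where "side = (\<lambda>n::nat. s * (- 1) ^ n)"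
  define Q where "Q = rec_nat q (\<lambda>n p. flow (side n) (duration (side n) (outspeed (side n) p)) p)"
  define d where "d = (\<lambda>n. duration (side n) (outspeed (side n) (Q n)))"
  define t where "t = (\<lambda>n. \<Sum>i<n. d i)"
  have Q0: "Q 0 = q" and QS: "Q (Suc n) = flow (side n) (d n) (Q n)" for n
    by (simp_all add: Q_def d_def)
  have side: "side n \<in> {1, -1}" "side (Suc n) = - side n" for n
    using s by (auto simp: side_def minus_one_power_iff)
  have ex: "exits (side n) (Q n)" for n
  proof (induction n)
    case 0
    then show ?case using q by (simp add: Q0 side_def)
  next
    case (Suc n)
    then have y: "f (Q n) = 0" "outspeed (side n) (Q n) > 0" by (auto simp: exits_def)
    show ?case unfolding side(2) QS d_def
      by (rule arrival_exits[OF side(1)])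
        (use flow_arc(2,3)[OF side(1) y] impact_pos[OF side(1) y(2)] in auto)
  qed
  have piece: "sol {t n..t (Suc n)} (\<lambda>r. flow (side n) (r + - t n) (Q n))" for n
  proof (rule crossing_solution_shift)
    have y: "f (Q n) = 0" "outspeed (side n) (Q n) > 0" using ex[of n] by (auto simp: exits_def)
    show "sol {0..d n} (\<lambda>r. flow (side n) r (Q n))"
    proof (rule arc_sol[OF side(1)])
      show "side n * f (flow (side n) r (Q n)) > 0" if "0 < r" "r < d n" for r
        using flow_arc(1)[OF side(1) y] that by (simp add: d_def)
      show "side n * f (Q n) > 0 \<or> crossing (Q n)"
        using ex[of n] side(1)[of n] by (auto simp: crossing_point_iff)
      show "crossing (flow (side n) (d n) (Q n))"
        using ex[of "Suc n"] side(1)[of "Suc n"] unfolding QS[symmetric] by (auto simp: crossing_point_iff)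
    qed
  qed (auto simp: t_def)
  have "min_duration \<le> d n" for n
    unfolding d_def by (rule min_duration_le[OF side(1) ex])
  then obtain X where "sol {t 0..} X" "X (t 0) = flow (side 0) (t 0 + - t 0) (Q 0)"
    using crossing_solution_concatenate[where piece = "\<lambda>n r. flow (side n) (r + - t n) (Q n)" and t = t,
        OF piece _ _ min_duration_pos] by (auto simp: QS t_def)
  then show ?thesis using that by (auto simp: t_def Q0)
qed

lemma sol_exists:
  assumes "f p \<noteq> 0 \<or> crossing p"
  obtains X where "sol {0..} X" "X 0 = p"
proof (cases "f p = 0")
  case True
  then obtain s where "s \<in> {1, -1}" "exits s p" using assms crossing_point_iff by blast
  then show ?thesis using sol_from_exit that by blast
next
  case False
  define s where "s = sgn (f p)"
  have s: "s \<in> {1, -1}" "s * f p > 0" using False by (auto simp: s_def sgn_if)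
  from arrival[OF this] obtain t where t: "t > 0" "f (flow s t p) = 0"
    "\<And>r. 0 \<le> r \<Longrightarrow> r < t \<Longrightarrow> s * f (flow s r p) > 0" "outspeed s (flow s t p) < 0" by blast
  have ex: "exits (- s) (flow s t p)" by (rule arrival_exits[OF s(1) t(2,4)])
  obtain X where X: "sol {0..} X" "X 0 = flow s t p"
    using sol_from_exit[OF other_side[OF s(1)] ex] by blast
  define Y where "Y = (\<lambda>r. if r \<le> t then flow s r p else X (r + - t))"
  have "sol {0..t} (\<lambda>r. flow s r p)"
  proof (rule arc_sol[OF s(1)])
    show "crossing (flow s t p)" using ex s(1) by (auto simp: crossing_point_iff)
  qed (use s t(3) in auto)
  then have "sol {0..t} Y" by (rule crossing_solution_cong) (simp add: Y_def)
  moreover have "sol {t..} (\<lambda>r. X (r + - t))" by (rule crossing_solution_shift[OF X(1)]) auto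
  then have "sol {t..} Y" by (rule crossing_solution_cong) (use X(2) in \<open>auto simp: Y_def\<close>)
  ultimately have "sol ({0..t} \<union> {t..}) Y" by (rule crossing_solution_Un) auto
  moreover have "{0..t} \<union> {t..} = {0..}" using t(1) by auto
  ultimately show ?thesis using that[of Y] t(1) by (simp add: Y_def)
qed

lemma sol_deterministic:
  assumes x: "sol I x" "{a..} \<subseteq> I" and z: "sol J z" "{b..} \<subseteq> J"
    and s: "s \<in> {1, -1}" and q: "exits s (x a)" and eq: "z b = x a" and r: "r \<ge> 0"
  shows "z (b + r) = x (a + r)"
proof -
  have "z (b + r) = x (a + r)"
    if "s \<in> {1, -1}" "exits s (x a)" "z b = x a" "{a..} \<subseteq> I" "{b..} \<subseteq> J" "0 \<le> r" "r \<le> n * min_duration" for n :: nat and s a b r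
    using that
  proof (induction n arbitrary: s a b r)
    case (Suc n)
    define d where "d = duration s (outspeed s (x a))"
    have q': "exits s (z b)" "duration s (outspeed s (z b)) = d" using Suc.prems(2,3) by (auto simp: d_def)
    have flow: "z (b + r) = x (a + r)" if "0 \<le> r" "r \<le> d" for r
    proof -
      have "x (a + r) = flow s r (x a)"
        by (rule sol_after_exit[OF x(1) Suc.prems(1,2)]) (use that Suc.prems d_def in auto)
      moreover have "z (b + r) = flow s r (z b)"
        by (rule sol_after_exit[OF z(1) Suc.prems(1) q'(1)]) (use that Suc.prems q' in auto)
      ultimately show ?thesis using Suc.prems(3) by simp
    qed
    have d: "min_duration \<le> d" unfolding d_def by (rule min_duration_le[OF Suc.prems(1,2)])
    show ?case
    proof (cases "r \<le> d")
      case True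
      then show ?thesis using flow Suc.prems by simp
    next
      case False
      have "z ((b + d) + (r - d)) = x ((a + d) + (r - d))"
      proof (rule Suc.IH)
        show "- s \<in> {1, -1}" using Suc.prems(1) by auto
        show "exits (- s) (x (a + d))" unfolding d_def by (rule half_turn[OF x(1) Suc.prems(1,2,4)])
        show "r - d \<le> n * min_duration" using Suc.prems(7) d by (simp add: algebra_simps)
        show "z (b + d) = x (a + d)" using flow d min_duration_pos by simp
      qed (use Suc.prems False d min_duration_pos in auto)
      then show ?thesis by simp
    qed
  qed simp
  moreover obtain n :: nat where "r / min_duration < n" using reals_Archimedean2 by blast
  then have "r \<le> n * min_duration" using min_duration_pos by (simp add: field_simps)
  ultimately show ?thesis using assms by blast
qed

lemma step_contracts:
  assumes "s \<in> {1, -1}" "y > 0" "y \<noteq> star s"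
  shows "\<bar>impact s y + gain - star (- s)\<bar> < \<bar>y - star s\<bar>"
  using impact_contracts[OF assms(1,2) star_pos[OF assms(1)] assms(3)] star_other_side[OF assms(1)] by simp

text \<open>
  The flight over side \<open>s\<close> that starts with speed \<open>star s\<close>; the
  periodic orbit consists of the two flights.
\<close>

definition cycle_arc where
  "cycle_arc s = (\<lambda>r. flow s r (section_point s (star s))) ` {0..duration s (star s)}"

definition cycle where "cycle = cycle_arc 1 \<union> cycle_arc (- 1)"

lemma cycle_arc_subset: "s \<in> {1, -1} \<Longrightarrow> cycle_arc s \<subseteq> cycle"
  by (auto simp: cycle_def)

lemma section_point_star: "s \<in> {1, -1} \<Longrightarrow> f q = 0 \<Longrightarrow> outspeed s q = star s \<Longrightarrow> section_point s (star s) = q"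
  using section_point_outspeed[of s q] by simp

lemma exits_star: "s \<in> {1, -1} \<Longrightarrow> exits s (section_point s (star s))"
  using star_greater by (simp add: exits_iff f_section_point outspeed_section_point)

lemma sol_covers_cycle_arc:
  assumes x: "sol I x" "{a..} \<subseteq> I" and s: "s \<in> {1, -1}" and q: "exits s (x a)" "outspeed s (x a) = star s"
  shows "cycle_arc s = x ` {a..a + duration s (star s)}"
proof -
  have "section_point s (star s) = x a" using q s by (intro section_point_star) (auto simp: exits_def)
  then have "cycle_arc s = (\<lambda>r. flow s r (x a)) ` {0..duration s (star s)}" by (simp add: cycle_arc_def)
  also have "\<dots> = (\<lambda>r. x (a + r)) ` {0..duration s (star s)}"
    by (rule image_cong[OF refl], rule sol_after_exit[symmetric, OF x(1) s q(1)]) (use x(2) q(2) in auto)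
  also have "\<dots> = x ` ((+) a ` {0..duration s (star s)})" by (simp only: image_image)
  finally show ?thesis by (simp add: add.commute)
qed

lemma sol_stays_on_cycle:
  assumes x: "sol I x" "{a..} \<subseteq> I" and s: "s \<in> {1, -1}" and q: "exits s (x a)" "outspeed s (x a) = star s"
    and t: "t \<ge> a"
  shows "x t \<in> cycle"
proof -
  have "x t \<in> cycle"
    if "s \<in> {1, -1}" "exits s (x a)" "outspeed s (x a) = star s" "{a..} \<subseteq> I" "a \<le> t" "t \<le> a + n * min_duration" for n :: nat and s a
    using that
  proof (induction n arbitrary: s a)
    case 0
    then have "x t \<in> cycle_arc s"
      using sol_covers_cycle_arc[OF x(1) 0(4,1,2,3)] duration_pos[OF 0(1) star_pos[OF 0(1)]] by auto
    then show ?case using cycle_arc_subset 0(1) by blast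
  next
    case (Suc n)
    show ?case
    proof (cases "t \<le> a + duration s (star s)")
      case True
      then have "x t \<in> cycle_arc s"
        using sol_covers_cycle_arc[OF x(1) Suc.prems(4,1,2,3)] Suc.prems(5) by auto
      then show ?thesis using cycle_arc_subset Suc.prems(1) by blast
    next
      case False
      show ?thesis
      proof (rule Suc.IH)
        show "- s \<in> {1, -1}" using Suc.prems(1) by auto
        show "exits (- s) (x (a + duration s (star s)))"
          using half_turn(2)[OF x(1) Suc.prems(1,2,4)] Suc.prems(3) by simp
        show "outspeed (- s) (x (a + duration s (star s))) = star (- s)"
          using half_turn(3)[OF x(1) Suc.prems(1,2,4)] Suc.prems(3) star_other_side[OF Suc.prems(1)] by simp
        show "{a + duration s (star s)..} \<subseteq> I"
          using Suc.prems(4) duration_pos[OF Suc.prems(1) star_pos[OF Suc.prems(1)]] by auto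
        show "t \<le> a + duration s (star s) + n * min_duration"
          using Suc.prems(6) min_duration_le[OF Suc.prems(1,2)] Suc.prems(3) by (simp add: algebra_simps)
      qed (use False in auto)
    qed
  qed
  moreover obtain n :: nat where "(t - a) / min_duration < n" using reals_Archimedean2 by blast
  then have "t \<le> a + n * min_duration" using min_duration_pos by (simp add: field_simps)
  ultimately show ?thesis using assms by blast
qed

end


section \<open>Uniqueness, existence and stability of the cycle\<close>

context welander_cycle
begin

text \<open>
  Half turns strictly reduce the distance to the speeds \<open>star\<close>, so at a crossing
  where this distance is minimal it vanishes. From there on the orbit runs along the cycle, and
  by periodicity the whole orbit does.
\<close>

lemma periodic_orbit_eq_cycle:
  assumes "crossing_periodic_orbit \<alpha> \<beta> k0 k1 \<epsilon> \<Gamma>"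
  shows "\<Gamma> = cycle"
  using assms
proof (rule periodic_orbit_minimal_crossing[where v = "\<lambda>s q. \<bar>outspeed s q - star s\<bar>"])
  fix x P t s
  assume P: "P > 0" "\<And>t. x (t + P) = x t" and x: "sol UNIV x" and \<Gamma>: "\<Gamma> = range x"
    and s: "s \<in> {1, -1}" and q: "exits s (x t)"
    and le: "\<bar>outspeed s (x t) - star s\<bar>
      \<le> \<bar>outspeed (- s) (x (t + duration s (outspeed s (x t)))) - star (- s)\<bar>"
  have y: "outspeed s (x t) = star s"
  proof (rule ccontr)
    assume "outspeed s (x t) \<noteq> star s"
    then show False
      using le step_contracts[OF s, of "outspeed s (x t)"] half_turn(3)[OF x s q] q by (simp add: exits_def)
  qed
  define b where "b = t + duration s (star s)"
  have b: "exits (- s) (x b)" "outspeed (- s) (x b) = star (- s)"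
    using half_turn(2,3)[OF x s q] y star_other_side[OF s] by (simp_all add: b_def)
  have "cycle_arc s \<subseteq> \<Gamma>" "cycle_arc (- s) \<subseteq> \<Gamma>"
    using sol_covers_cycle_arc[OF x _ s q y] sol_covers_cycle_arc[OF x _ other_side[OF s] b]
    by (auto simp: \<Gamma>)
  then have "cycle \<subseteq> \<Gamma>" using s by (auto simp: cycle_def)
  moreover have "x r \<in> cycle" for r
  proof -
    have per: "x (r + real n * P) = x r" for n r
    proof (induction n)
      case (Suc n)
      then show ?case using P(2)[of "r + real n * P"] by (simp add: algebra_simps)
    qed simp
    obtain n :: nat where "(t - r) / P < n" using reals_Archimedean2 by blast
    then have "t \<le> r + n * P" using P(1) by (simp add: field_simps)
    then have "x (r + n * P) \<in> cycle" by (intro sol_stays_on_cycle[OF x _ s q y]) auto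
    then show ?thesis by (simp add: per)
  qed
  ultimately show "\<Gamma> = cycle" by (auto simp: \<Gamma>)
qed

text \<open>
  The forward solution that starts with speed \<open>star 1\<close> is back at its starting
  point after two flights, and then repeats itself by forward uniqueness. Its periodic extension
  to negative times is again a crossing solution.
\<close>

lemma periodic_orbit_exists: "\<exists>\<Gamma>. crossing_periodic_orbit \<alpha> \<beta> k0 k1 \<epsilon> \<Gamma>"
proof -
  let ?q = "section_point 1 (star 1)"
  have one: "(1::real) \<in> {1, -1}" by simp
  obtain X where X: "sol {0..} X" "X 0 = ?q"
    using sol_from_exit[OF one exits_star[OF one]] by blast
  define d1 d2 where "d1 = duration 1 (star 1)" and "d2 = duration (- 1) (star (- 1))"
  define P where "P = d1 + d2"
  have d: "d1 > 0" "d2 > 0" using duration_pos star_pos by (auto simp: d1_def d2_def)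
  have q: "exits 1 (X 0)" "outspeed 1 (X 0) = star 1"
    using exits_star[OF one] outspeed_section_point[OF one] X(2) by auto
  have q1: "exits (- 1) (X d1)" "outspeed (- 1) (X d1) = star (- 1)"
    using half_turn(2,3)[OF X(1) one q(1)] q(2) star_other_side[OF one] by (auto simp: d1_def)
  have sub: "{d1..} \<subseteq> {0..}" using d by auto
  have "exits (- (- 1)) (X P)" "outspeed (- (- 1)) (X P) = star (- (- 1))"
    using half_turn(2,3)[OF X(1) other_side[OF one] q1(1) sub] q1(2) star_other_side[OF other_side[OF one]]
    by (auto simp: P_def d2_def)
  then have q2: "X P = X 0"
    using section_point_star[OF one, of "X P"] X(2) by (auto simp: exits_def)
  have P: "P > 0" using d by (simp add: P_def)
  have step: "X (r + P) = X r" if "r \<ge> 0" for r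
    using sol_deterministic[OF X(1) _ X(1) _ one q(1) q2 that] P by (auto simp: add.commute)
  have per: "X (r + real n * P) = X r" if "r \<ge> 0" for r n
  proof (induction n)
    case (Suc n)
    then show ?case using step[of "r + real n * P"] that P by (simp add: algebra_simps)
  qed simp
  \<comment> \<open>The argument of $X$ is the remainder of $t$ modulo $P$.\<close>
  define x where "x = (\<lambda>t. X (t - P * of_int \<lfloor>t / P\<rfloor>))"
  have frac: "0 \<le> t - P * of_int \<lfloor>t / P\<rfloor>" for t
    using mult_left_mono[OF of_int_floor_le[of "t / P"], of P] P by simp
  have xX: "x t = X (t + n * P)" if "t + real n * P \<ge> 0" for t n
  proof -
    have "0 \<le> \<lfloor>t / P\<rfloor> + int n"
    proof -
      have "- real n \<le> t / P" using that P by (simp add: field_simps)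
      then have "- int n \<le> \<lfloor>t / P\<rfloor>" by (simp add: le_floor_iff)
      then show ?thesis by simp
    qed
    then obtain m where "\<lfloor>t / P\<rfloor> + int n = int m" using nonneg_int_cases by blast
    then have m: "real m = real_of_int \<lfloor>t / P\<rfloor> + real n" by linarith
    have "t + n * P = (t - P * of_int \<lfloor>t / P\<rfloor>) + real m * P" unfolding m by (simp add: algebra_simps)
    then show ?thesis by (simp only: x_def per[OF frac])
  qed
  have "sol UNIV x"
  proof (rule crossing_solution_exhaust)
    fix r
    obtain n :: nat where "r / P < n" using reals_Archimedean2 by blast
    then have n: "r \<le> n * P" using P by (simp add: field_simps)
    have "sol {- r..r} (\<lambda>t. X (t + n * P))"
      by (rule crossing_solution_shift[OF X(1)]) (use n in auto)
    then show "sol (UNIV \<inter> {- r..r}) x"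
      by (rule_tac crossing_solution_cong[of _ _ _ _ _ _ "\<lambda>t. X (t + n * P)"]) (use n in \<open>auto intro!: xX\<close>)
  qed
  moreover have xP: "x (t + P) = x t" for t
  proof -
    have "\<lfloor>(t + P) / P\<rfloor> = \<lfloor>t / P\<rfloor> + 1" using P by (simp add: add_divide_distrib)
    then show ?thesis unfolding x_def by (simp add: algebra_simps)
  qed
  moreover have "range x \<inter> switch_line \<alpha> \<epsilon> \<noteq> {}"
  proof -
    have "x 0 \<in> switch_line \<alpha> \<epsilon>" using X(2) f_section_point by (simp add: x_def switch_line_iff)
    then show ?thesis by blast
  qed
  moreover have "finite (range x \<inter> switch_line \<alpha> \<epsilon>)"
  proof -
    have "range x \<inter> switch_line \<alpha> \<epsilon> \<subseteq> X ` {t \<in> {0..} \<inter> {0..P}. X t \<in> switch_line \<alpha> \<epsilon>}"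
    proof
      fix p assume "p \<in> range x \<inter> switch_line \<alpha> \<epsilon>"
      then obtain t where t: "p = x t" "p \<in> switch_line \<alpha> \<epsilon>" by blast
      define u where "u = t - P * of_int \<lfloor>t / P\<rfloor>"
      have "t / P < of_int \<lfloor>t / P\<rfloor> + 1" by linarith
      then have "u \<le> P" using P by (simp add: u_def field_simps)
      moreover have "0 \<le> u" "p = X u" using frac[of t] t(1) by (simp_all add: u_def x_def)
      ultimately show "p \<in> X ` {t \<in> {0..} \<inter> {0..P}. X t \<in> switch_line \<alpha> \<epsilon>}"
        using t(2) by (intro image_eqI[of _ _ u]) simp_all
    qed
    moreover have "finite {t \<in> {0..} \<inter> {0..P}. X t \<in> switch_line \<alpha> \<epsilon>}"
      using X(1) unfolding crossing_solution_def by blast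
    ultimately show ?thesis using finite_subset by blast
  qed
  ultimately show ?thesis using P unfolding crossing_periodic_orbit_def by blast
qed

text \<open>
  A flight with almost the right initial speed is compared with the cycle's own flight at the
  same time, or with the end of the latter if it is over already. The flow shrinks the distance
  of the starting points, and in the second case the excess in time is small because the
  duration is continuous in the initial speed.
\<close>

lemma nearby_arc_close:
  assumes s: "s \<in> {1, -1}" and z: "\<zeta> > 0"
  obtains e where "e > 0" "\<And>q t. exits s q \<Longrightarrow> \<bar>outspeed s q - star s\<bar> < e \<Longrightarrow>
    t \<in> {0..duration s (outspeed s q)} \<Longrightarrow> infdist (flow s t q) cycle < \<zeta>"
proof -
  define p where "p = section_point s"
  \<comment> \<open>The bound on the distance: a speed bound times the difference of the durations,
    plus the distance of the starting points.\<close>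
  define B where "B = (\<lambda>y. (lam s * \<bar>fst (p y) - fst (node s)\<bar> + mu s * \<bar>snd (p y) - snd (node s)\<bar>)
      * \<bar>duration s y - duration s (star s)\<bar> + dist (p y) (p (star s)))"
  have "isCont p (star s)" unfolding p_def section_point_def[abs_def] Let_def
    using nondegenerate by (intro continuous_intros) auto
  then have "isCont B (star s)" unfolding B_def
    by (intro continuous_intros duration_isCont[OF s star_pos[OF s]])
  then obtain e where e: "e > 0" "\<And>y. \<bar>y - star s\<bar> < e \<Longrightarrow> dist (B y) (B (star s)) < \<zeta>"
    using z unfolding continuous_at_eps_delta dist_real_def by blast
  have B0: "B (star s) = 0" by (simp add: B_def)
  show ?thesis
  proof (rule that[OF e(1)])
    fix q t assume q: "exits s q" and close: "\<bar>outspeed s q - star s\<bar> < e"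
      and t: "t \<in> {0..duration s (outspeed s q)}"
    define y where "y = outspeed s q"
    have qy: "q = p y" using section_point_outspeed[OF s, of q] q by (simp add: exits_def p_def y_def)
    define r where "r = min t (duration s (star s))"
    have r: "r \<in> {0..duration s (star s)}" "\<bar>t - r\<bar> \<le> \<bar>duration s y - duration s (star s)\<bar>"
      using t duration_pos[OF s star_pos[OF s]] by (auto simp: r_def y_def)
    have "flow s r (p (star s)) \<in> cycle"
      using r(1) cycle_arc_subset[OF s] by (auto simp: cycle_arc_def p_def)
    then have "infdist (flow s t q) cycle \<le> dist (flow s t q) (flow s r (p (star s)))"
      by (rule infdist_le)
    also have "\<dots> \<le> dist (flow s t q) (flow s r q) + dist (flow s r q) (flow s r (p (star s)))"
      by (rule dist_triangle)
    also have "\<dots> \<le> B y"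
    proof -
      have "dist (flow s t q) (flow s r q)
         \<le> (lam s * \<bar>fst q - fst (node s)\<bar> + mu s * \<bar>snd q - snd (node s)\<bar>) * \<bar>t - r\<bar>"
        using t r by (intro flow_time_lipschitz) auto
      also have "\<dots> \<le> (lam s * \<bar>fst q - fst (node s)\<bar> + mu s * \<bar>snd q - snd (node s)\<bar>)
          * \<bar>duration s y - duration s (star s)\<bar>"
        using r(2) rates[of s] by (intro mult_left_mono) auto
      finally show ?thesis
        using flow_nonexpansive[of r s q "p (star s)"] r(1) unfolding B_def qy[symmetric] by auto
    qed
    also have "\<dots> < \<zeta>" using e(2)[OF close] by (simp add: B0 y_def)
    finally show "infdist (flow s t q) cycle < \<zeta>" .
  qed
qed

text \<open>
  Half turns never increase the distance to \<open>star\<close>, so a solution that once starts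
  a flight with nearly the right speed does so at all later crossings.
\<close>

lemma cycle_traps:
  assumes "\<zeta> > 0"
  obtains e where "e > 0" "\<And>I x s a t. sol I x \<Longrightarrow> {a..} \<subseteq> I \<Longrightarrow> s \<in> {1, -1} \<Longrightarrow> exits s (x a) \<Longrightarrow>
     \<bar>outspeed s (x a) - star s\<bar> < e \<Longrightarrow> a \<le> t \<Longrightarrow> infdist (x t) cycle < \<zeta>"
proof -
  obtain e1 where e1: "e1 > 0" "\<And>q t. exits 1 q \<Longrightarrow> \<bar>outspeed 1 q - star 1\<bar> < e1 \<Longrightarrow>
    t \<in> {0..duration 1 (outspeed 1 q)} \<Longrightarrow> infdist (flow 1 t q) cycle < \<zeta>"
    using nearby_arc_close[of 1, OF _ assms] by blast
  obtain e2 where e2: "e2 > 0" "\<And>q t. exits (- 1) q \<Longrightarrow> \<bar>outspeed (- 1) q - star (- 1)\<bar> < e2 \<Longrightarrow>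
    t \<in> {0..duration (- 1) (outspeed (- 1) q)} \<Longrightarrow> infdist (flow (- 1) t q) cycle < \<zeta>"
    using nearby_arc_close[of "- 1", OF _ assms] by blast
  define e where "e = min e1 e2"
  have e: "infdist (flow s t q) cycle < \<zeta>"
    if "s \<in> {1, -1}" "exits s q" "\<bar>outspeed s q - star s\<bar> < e" "t \<in> {0..duration s (outspeed s q)}" for s t q
    using that e1(2)[of q t] e2(2)[of q t] by (auto simp: e_def)
  show ?thesis
  proof (rule that[of e])
    show "e > 0" using e1 e2 by (simp add: e_def)
    fix I x s a t
    assume x: "sol I x" and *: "{a..} \<subseteq> I" "s \<in> {1, -1}" "exits s (x a)" "\<bar>outspeed s (x a) - star s\<bar> < e" "a \<le> t"
    have "infdist (x t) cycle < \<zeta>"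
      if "{a..} \<subseteq> I" "s \<in> {1, -1}" "exits s (x a)" "\<bar>outspeed s (x a) - star s\<bar> < e"
        "a \<le> t" "t < a + n * min_duration" for n :: nat and s a
      using that
    proof (induction n arbitrary: s a)
      case (Suc n)
      define d where "d = duration s (outspeed s (x a))"
      have d: "min_duration \<le> d" unfolding d_def by (rule min_duration_le[OF Suc.prems(2,3)])
      show ?case
      proof (cases "t \<le> a + d")
        case True
        have "x (a + (t - a)) = flow s (t - a) (x a)"
          by (rule sol_after_exit[OF x Suc.prems(2,3)]) (use True Suc.prems d_def in auto)
        then show ?thesis using e[OF Suc.prems(2,3,4), of "t - a"] True Suc.prems(5) by (simp add: d_def)
      next
        case False
        note h = half_turn[OF x Suc.prems(2,3,1), folded d_def]
        have y: "outspeed s (x a) > 0" using Suc.prems(3) by (simp add: exits_def)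
        show ?thesis
        proof (rule Suc.IH)
          show "- s \<in> {1, -1}" using Suc.prems(2) by auto
          show "exits (- s) (x (a + d))" by (rule h(2))
          show "\<bar>outspeed (- s) (x (a + d)) - star (- s)\<bar> < e"
          proof (cases "outspeed s (x a) = star s")
            case True
            then show ?thesis using h(3) star_other_side[OF Suc.prems(2)] \<open>e > 0\<close> by simp
          next
            case False
            then show ?thesis using h(3) step_contracts[OF Suc.prems(2) y] Suc.prems(4) by simp
          qed
          show "{a + d..} \<subseteq> I" using Suc.prems(1) d min_duration_pos by auto
          show "t < a + d + n * min_duration" using Suc.prems(6) d by (simp add: algebra_simps)
        qed (use False in auto)
      qed
    qed simp
    moreover obtain n :: nat where "(t - a) / min_duration < n" using reals_Archimedean2 by blast
    then have "t < a + n * min_duration" using min_duration_pos by (simp add: field_simps)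
    ultimately show "infdist (x t) cycle < \<zeta>" using * by blast
  qed
qed

text \<open>
  The strict decrease of the distance to \<open>star\<close> in a half turn is uniform on
  compact sets of speeds away from \<open>star\<close>.
\<close>

lemma uniform_contraction:
  assumes s: "s \<in> {1, -1}" and e: "e > 0"
  obtains \<rho> where "\<rho> > 0" "\<And>y. y \<ge> gain \<Longrightarrow> e \<le> \<bar>y - star s\<bar> \<Longrightarrow> \<bar>y - star s\<bar> \<le> E \<Longrightarrow>
    \<bar>impact s y + gain - star (- s)\<bar> \<le> \<bar>y - star s\<bar> - \<rho>"
proof -
  define K where "K = {gain..star s + E} \<inter> {y. e \<le> \<bar>y - star s\<bar>}"
  define v where "v = (\<lambda>y. \<bar>y - star s\<bar> - \<bar>impact s y + gain - star (- s)\<bar>)"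
  have "compact K" unfolding K_def
    by (intro compact_Int_closed compact_Icc closed_Collect_le continuous_intros)
  have "continuous_on K v" unfolding v_def
    by (intro continuous_intros continuous_on_subset[OF impact_continuous_on[OF s]])
      (use gain_pos in \<open>auto simp: K_def\<close>)
  have pos: "v y > 0" if "y \<in> K" for y
    using step_contracts[OF s, of y] that e gain_pos by (auto simp: v_def K_def)
  obtain \<rho> where "\<rho> > 0" "\<And>y. y \<in> K \<Longrightarrow> \<rho> \<le> v y"
  proof (cases "K = {}")
    case True
    then show ?thesis using that[of 1] by auto
  next
    case False
    from continuous_attains_inf[OF \<open>compact K\<close> False \<open>continuous_on K v\<close>] obtain y
      where "y \<in> K" "\<And>z. z \<in> K \<Longrightarrow> v y \<le> v z" by blast
    then show ?thesis using that[of "v y"] pos by blast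
  qed
  then show ?thesis
    using that[of \<rho>] by (force simp: K_def v_def)
qed

text \<open>
  As long as the distance to \<open>star\<close> is at least \<open>e\<close>, each half turn
  reduces it by a fixed amount.
\<close>

lemma sol_gets_close:
  assumes x: "sol I x" "{a..} \<subseteq> I" and s: "s \<in> {1, -1}" and q: "exits s (x a)" and e: "e > 0"
  obtains r b where "b \<ge> a" "r \<in> {1, -1}" "exits r (x b)" "\<bar>outspeed r (x b) - star r\<bar> < e"
proof -
  define E where "E = \<bar>outspeed s (x a) - star s\<bar>"
  obtain \<rho>1 where \<rho>1: "\<rho>1 > 0" "\<And>y. y \<ge> gain \<Longrightarrow> e \<le> \<bar>y - star 1\<bar> \<Longrightarrow> \<bar>y - star 1\<bar> \<le> E \<Longrightarrow>
    \<bar>impact 1 y + gain - star (- 1)\<bar> \<le> \<bar>y - star 1\<bar> - \<rho>1"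
    using uniform_contraction[of 1, OF _ e] by blast
  obtain \<rho>2 where \<rho>2: "\<rho>2 > 0" "\<And>y. y \<ge> gain \<Longrightarrow> e \<le> \<bar>y - star (- 1)\<bar> \<Longrightarrow> \<bar>y - star (- 1)\<bar> \<le> E \<Longrightarrow>
    \<bar>impact (- 1) y + gain - star (- (- 1))\<bar> \<le> \<bar>y - star (- 1)\<bar> - \<rho>2"
    using uniform_contraction[of "- 1", OF _ e] by blast
  define \<rho> where "\<rho> = min \<rho>1 \<rho>2"
  have \<rho>: "\<rho> > 0" using \<rho>1 \<rho>2 by (simp add: \<rho>_def)
  have step: "\<bar>impact s y + gain - star (- s)\<bar> \<le> \<bar>y - star s\<bar> - \<rho>"
    if "s \<in> {1, -1}" "y \<ge> gain" "e \<le> \<bar>y - star s\<bar>" "\<bar>y - star s\<bar> \<le> E" for s y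
    using that \<rho>1(2)[of y] \<rho>2(2)[of y] by (auto simp: \<rho>_def)
  have "\<exists>r b. b \<ge> a \<and> r \<in> {1, -1} \<and> exits r (x b) \<and> \<bar>outspeed r (x b) - star r\<bar> < e"
    if "{a..} \<subseteq> I" "s \<in> {1, -1}" "exits s (x a)" "\<bar>outspeed s (x a) - star s\<bar> \<le> E"
      "\<bar>outspeed s (x a) - star s\<bar> < e + n * \<rho>" for n :: nat and s a
    using that
  proof (induction n arbitrary: s a)
    case 0
    then show ?case by (intro exI[of _ s] exI[of _ a]) simp
  next
    case (Suc n)
    show ?case
    proof (cases "\<bar>outspeed s (x a) - star s\<bar> < e")
      case True
      then show ?thesis using Suc.prems by (intro exI[of _ s] exI[of _ a]) simp
    next
      case False
      define d where "d = duration s (outspeed s (x a))"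
      note h = half_turn[OF x(1) Suc.prems(2,3,1), folded d_def]
      have c: "\<bar>outspeed (- s) (x (a + d)) - star (- s)\<bar> \<le> \<bar>outspeed s (x a) - star s\<bar> - \<rho>"
        unfolding h(3) by (rule step) (use Suc.prems False in \<open>auto simp: exits_iff\<close>)
      have "\<exists>r b. b \<ge> a + d \<and> r \<in> {1, -1} \<and> exits r (x b) \<and> \<bar>outspeed r (x b) - star r\<bar> < e"
      proof (rule Suc.IH)
        show "- s \<in> {1, -1}" using Suc.prems(2) by auto
        show "\<bar>outspeed (- s) (x (a + d)) - star (- s)\<bar> \<le> E" using c Suc.prems(4) \<rho> by simp
        show "\<bar>outspeed (- s) (x (a + d)) - star (- s)\<bar> < e + n * \<rho>"
          using c Suc.prems(5) by (simp add: algebra_simps)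
        show "{a + d..} \<subseteq> I" using Suc.prems(1) h(1) by auto
      qed (rule h(2))
      then show ?thesis using h(1) by (meson less_imp_le order_trans)
    qed
  qed
  moreover obtain n :: nat where "E / \<rho> < n" using reals_Archimedean2 by blast
  then have "E < e + n * \<rho>" using \<rho> e by (simp add: field_simps add_strict_increasing)
  ultimately show ?thesis using that x(2) s q unfolding E_def by blast
qed

lemma sol_reaches_switch_line:
  assumes x: "sol {0..} x"
  obtains a s where "a \<ge> 0" "s \<in> {1, -1}" "exits s (x a)"
proof (cases "f (x 0) = 0")
  case True
  then have "crossing (x 0)" using x by (simp add: crossing_solution_def switch_line_iff)
  then show ?thesis using that[of 0] crossing_point_iff by auto
next
  case False
  define s where "s = sgn (f (x 0))"
  have s: "s \<in> {1, -1}" "s * f (x 0) > 0" using False by (auto simp: s_def sgn_if)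
  from arrival[OF this] obtain t where t: "t > 0" "f (flow s t (x 0)) = 0"
    "\<And>r. 0 \<le> r \<Longrightarrow> r < t \<Longrightarrow> s * f (flow s r (x 0)) > 0" "outspeed s (flow s t (x 0)) < 0" by blast
  have "x (0 + t) = flow s t (x 0)"
  proof (rule sol_follows_flow[OF x _ s(1) t(1)])
    show "\<exists>r>0. r < b \<and> - s * f (x r) \<le> 0" if b: "0 < b" "b \<le> 0 + t" for b
    proof -
      have "continuous_on {0..} (\<lambda>r. s * f (x r))"
        using x by (intro continuous_intros) (simp add: crossing_solution_def)
      from this[unfolded continuous_on_iff, rule_format, of 0 "s * f (x 0)"] s(2)
      obtain d where d: "d > 0" "\<And>r. r \<in> {0..} \<Longrightarrow> dist r 0 < d \<Longrightarrow> dist (s * f (x r)) (s * f (x 0)) < s * f (x 0)"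
        by auto
      define r where "r = min d b / 2"
      have r: "0 < r" "r < b" "r < d" using d b by (auto simp: r_def)
      then have "s * f (x r) > 0" using d(2)[of r] by (auto simp: dist_real_def)
      then show ?thesis using r by (intro exI[of _ r]) simp
    qed
  qed (use t in auto)
  then have "exits (- s) (x t)" using arrival_exits[OF s(1) t(2,4)] by simp
  then show ?thesis using that[of t "- s"] t(1) s(1) by auto
qed

lemma sol_tends_to_cycle:
  assumes x: "sol {0..} x"
  shows "((\<lambda>t. infdist (x t) cycle) \<longlongrightarrow> 0) at_top"
proof (rule tendstoI)
  fix \<zeta> :: real assume "\<zeta> > 0"
  obtain e where e: "e > 0"
    "\<And>I x s a t. sol I x \<Longrightarrow> {a..} \<subseteq> I \<Longrightarrow> s \<in> {1, -1} \<Longrightarrow> exits s (x a) \<Longrightarrow>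
     \<bar>outspeed s (x a) - star s\<bar> < e \<Longrightarrow> a \<le> t \<Longrightarrow> infdist (x t) cycle < \<zeta>"
    by (rule cycle_traps[OF \<open>\<zeta> > 0\<close>]) blast
  obtain a s where a: "a \<ge> 0" "s \<in> {1, -1}" "exits s (x a)" using sol_reaches_switch_line[OF x] .
  have "{a..} \<subseteq> {0..}" using a by auto
  then obtain r b where
    b: "b \<ge> a" "r \<in> {1, -1}" "exits r (x b)" "\<bar>outspeed r (x b) - star r\<bar> < e"
    by (rule sol_gets_close[OF x _ a(2,3) e(1)])
  have "infdist (x t) cycle < \<zeta>" if "t \<ge> b" for t
    by (rule e(2)[OF x _ b(2,3,4) that]) (use a b in auto)
  then have "\<forall>t\<ge>b. dist (infdist (x t) cycle) 0 < \<zeta>"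
    by (simp add: dist_real_def infdist_nonneg)
  then show "eventually (\<lambda>t. dist (infdist (x t) cycle) 0 < \<zeta>) at_top"
    unfolding eventually_at_top_linorder by blast
qed

text \<open>
  Every crossing solution on $[0,\infty)$ tends to the cycle. Closeness of the initial point
  only serves the existence of such a solution: the points that have none lie on the switching
  line where the fields do not both cross in the same direction, a closed set that misses the
  compact cycle.
\<close>

lemma cycle_stable: "stable_orbit \<alpha> \<beta> k0 k1 \<epsilon> cycle"
proof -
  define bad where "bad = {p. f p = 0} \<inter> {p. outspeed 1 p * outspeed (- 1) p \<ge> 0}"
  have out: "continuous_on UNIV (outspeed s)" for s
    unfolding outspeed_eq[abs_def] by (intro continuous_intros)
  have "closed bad" unfolding bad_def
    by (intro closed_Int closed_Collect_eq closed_Collect_le continuous_intros out)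
  have good: "f p \<noteq> 0 \<or> crossing p" if "p \<notin> bad" for p
    using that by (auto simp: bad_def crossing_point_def switch_line_iff outspeed_def mix_def)
  have not_crossing: "\<not> crossing p" if "p \<in> bad" for p
    using that by (auto simp: bad_def crossing_point_def switch_line_iff outspeed_def mix_def)
  have "compact cycle" unfolding cycle_def cycle_arc_def
    by (intro compact_Un compact_continuous_image continuous_intros compact_Icc)
  have ne: "cycle \<noteq> {}"
    using duration_pos[OF _ star_pos, of 1 1] by (simp add: cycle_def cycle_arc_def)
  obtain \<Gamma> where \<Gamma>: "crossing_periodic_orbit \<alpha> \<beta> k0 k1 \<epsilon> \<Gamma>" using periodic_orbit_exists by blast
  then have "crossing_periodic_orbit \<alpha> \<beta> k0 k1 \<epsilon> cycle" using periodic_orbit_eq_cycle by simp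
  then obtain x where "sol UNIV x" "cycle = range x" unfolding crossing_periodic_orbit_def by blast
  have "p \<notin> bad" if p: "p \<in> cycle" for p
  proof
    assume "p \<in> bad"
    moreover from this have "crossing p"
      using \<open>sol UNIV x\<close> \<open>cycle = range x\<close> p by (auto simp: crossing_solution_def switch_line_iff bad_def)
    ultimately show False using not_crossing by blast
  qed
  then have "cycle \<inter> bad = {}" by blast
  from separate_compact_closed[OF \<open>compact cycle\<close> \<open>closed bad\<close> this] obtain d
    where d: "d > 0" "\<And>p q. p \<in> cycle \<Longrightarrow> q \<in> bad \<Longrightarrow> d \<le> dist p q" by blast
  have "p \<notin> bad" if "infdist p cycle < d" for p
  proof
    assume "p \<in> bad"
    obtain c where "c \<in> cycle" "infdist p cycle = dist p c"
      using infdist_attains_inf[OF compact_imp_closed[OF \<open>compact cycle\<close>] ne] by metis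
    then show False using d(2)[OF _ \<open>p \<in> bad\<close>, of c] that by (simp add: dist_commute)
  qed
  then have "\<exists>x. sol {0..} x \<and> x 0 = p" if "infdist p cycle < d" for p
    using sol_exists[OF good, of p] that by blast
  then show ?thesis unfolding stable_orbit_def using d(1) sol_tends_to_cycle by blast
qed

end

section \<open>Crossing periodic orbits of the Welander system\<close>

theorem theorem2:
  fixes \<alpha> \<beta> \<epsilon> k0 k1 :: real
  assumes "\<beta> > 0" and "0 \<le> k0" and "k0 < k1"
    and "\<alpha> * (1 - \<beta>) \<noteq> 0"
    and "\<alpha> < alpha_L \<beta> \<epsilon> k0" and "\<alpha> > alpha_R \<beta> \<epsilon> k1"
  shows "(\<epsilon> \<ge> 0 \<longrightarrow> \<not> (\<exists>\<Gamma>. crossing_periodic_orbit \<alpha> \<beta> k0 k1 \<epsilon> \<Gamma>)) \<and>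
         (\<epsilon> < 0 \<longrightarrow> (\<exists>!\<Gamma>. crossing_periodic_orbit \<alpha> \<beta> k0 k1 \<epsilon> \<Gamma>) \<and>
            (\<forall>\<Gamma>. crossing_periodic_orbit \<alpha> \<beta> k0 k1 \<epsilon> \<Gamma> \<longrightarrow> stable_orbit \<alpha> \<beta> k0 k1 \<epsilon> \<Gamma>))"
proof -
  interpret welander \<alpha> \<beta> k0 k1 \<epsilon> using assms by unfold_locales
  show ?thesis
  proof (intro conjI impI)
    show "\<not> (\<exists>\<Gamma>. crossing_periodic_orbit \<alpha> \<beta> k0 k1 \<epsilon> \<Gamma>)" if "\<epsilon> \<ge> 0"
      using no_crossing_periodic_orbit[OF that] by blast
    assume "\<epsilon> < 0"
    then have g: "gain > 0" using k0_less_k1 by (simp add: gain_def mult_neg_neg)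
    obtain y z where yz: "y > gain" "z > gain" "z = impact 1 y + gain" "y = impact (- 1) z + gain"
      using return_fixed_point[OF g] .
    interpret welander_cycle \<alpha> \<beta> k0 k1 \<epsilon> "\<lambda>s. if s = 1 then y else z"
    proof unfold_locales
      fix s :: real assume s: "s \<in> {1, -1}"
      show "(if s = 1 then y else z) > gain" using yz(1,2) by simp
      from s consider "s = 1" | "s = - 1" by auto
      then show "(if - s = 1 then y else z) = impact s (if s = 1 then y else z) + gain"
      proof cases
        case 1
        then show ?thesis using yz(3) by simp
      next
        case 2
        then show ?thesis using yz(4) by simp
      qed
    qed (rule g)
    show "\<exists>!\<Gamma>. crossing_periodic_orbit \<alpha> \<beta> k0 k1 \<epsilon> \<Gamma>"
      using periodic_orbit_exists periodic_orbit_eq_cycle by metis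
    show "\<forall>\<Gamma>. crossing_periodic_orbit \<alpha> \<beta> k0 k1 \<epsilon> \<Gamma> \<longrightarrow> stable_orbit \<alpha> \<beta> k0 k1 \<epsilon> \<Gamma>"
      using periodic_orbit_eq_cycle cycle_stable by blast
  qed
qed

end
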